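(* Let $p$ be a prime, let $\mathcal F$ be a saturated fusion system on a finite $p$-group $S$, and let $b\in B(S)$. (a) $b\in B(\mathcal F)$ if and only if $B(\mathrm{Res}^S_P)(b)\in B(P)^{\mathrm{Out}_{\mathcal F}(P)}$ for all $P\leq S$. (b) $b\in B(\mathcal F)$ if and only if $B(\mathrm{Res}^S_R)(b)\in B(R)^{\mathrm{Out}_{\mathcal F}(R)}$ for $R=S$ and for every $\mathcal F$-essential subgroup $R<S$.
   Context: Burnside rings: for a finite group $G$, $B(G)$ is the Grothendieck ring of finite left $G$-sets, with addition $[X]+[Y]=[X\sqcup Y]$ and multiplication $[X][Y]=[X\times Y]$. For $H\leq G$, the map $[X]\mapsto|X^H|$ extends to a ring morphism $B(G)\to\mathbb Z$, written $a\mapsto|a^H|$; the map $a\mapsto(|a^H|)_{H\leq G}$ is injective. For $H\leq G$, $B(\mathrm{Res}^G_H):B(G)\to B(H)$ is the ring morphism restricting the action to $H$. Fusion systems: a fusion system $\mathcal F$ on a finite $p$-group $S$ is a category whose objects are the subgroups of $S$ and whose morphisms are injective group homomorphisms, such that for $P,Q\leq S$ one has $\mathrm{Hom}_S(P,Q)\subseteq\mathrm{Hom}_{\mathcal F}(P,Q)$ (where $\mathrm{Hom}_S(P,Q)$ is the set of homomorphisms given by conjugation by an element of $S$), and every $\varphi\in\mathrm{Hom}_{\mathcal F}(P,Q)$ is the composition of an isomorphism in $\mathcal F$ and an inclusion of subgroups. Subgroups $P,Q$ are $\mathcal F$-conjugate if they are isomorphic in $\mathcal F$. $\mathrm{Aut}_{\mathcal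 F}(P)=\mathrm{Hom}_{\mathcal F}(P,P)$, $\mathrm{Aut}_S(P)=\mathrm{Hom}_S(P,P)$, $\mathrm{Out}_{\mathcal F}(P)=\mathrm{Aut}_{\mathcal F}(P)/\mathrm{Inn}(P)$. $P$ is fully $\mathcal F$-automized if $\mathrm{Aut}_S(P)\in\mathrm{Syl}_p(\mathrm{Aut}_{\mathcal F}(P))$, and receptive if every isomorphism $\varphi:Q\to P$ in $\mathcal F$ extends to a morphism in $\mathcal F$ defined on $N_\varphi=\{g\in N_S(Q):\varphi c_g\varphi^{-1}\in\mathrm{Aut}_S(P)\}$, where $c_g$ is conjugation by $g$. $\mathcal F$ is saturated if every subgroup of $S$ is $\mathcal F$-conjugate to one that is fully $\mathcal F$-automized and receptive. A subgroup $R$ is $\mathcal F$-essential if it is $\mathcal F$-centric ($C_S(Q)\leq Q$ for every $\mathcal F$-conjugate $Q$ of $R$), fully normalized ($|N_S(R)|\geq|N_S(Q)|$ for every $\mathcal F$-conjugate $Q$ of $R$), and $\mathrm{Out}_{\mathcal F}(R)$ has a strongly $p$-embedded subgroup (a proper subgroup $H$ with $p\mid|H|$ and $p\nmid|H\cap xHx^{-1}|$ for all $x\notin H$). The Burnside ring of $\mathcal F$ is the subring $B(\mathcal F)=\{a\in B(S): |a^P|=|a^Q|\text{ whenever }P,Q\leq S\text{ are }\mathcal F\text{-conjugate}\}$. Outer action: $\mathrm{Aut}(P)$ acts on $B(P)$ by ring automorphisms, where $\alpha\cdot[X]$ is the class of the $P$-set $X$ with action transported along $\alpha$ (i.e. $g$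 acts as $\alpha^{-1}(g)$); equivalently $|(\alpha\cdot b)^Q|=|b^{\alpha^{-1}(Q)}|$ for $Q\leq P$. $\mathrm{Inn}(P)$ acts trivially, so $\mathrm{Out}(P)$ acts on $B(P)$; for $\Gamma\leq\mathrm{Out}(P)$, $B(P)^\Gamma$ denotes the subring of $\Gamma$-fixed points. *)

theory Defs
  imports "HOL-Computational_Algebra.Primes" "HOL-Library.Nat_Bijection"
    "HOL-Algebra.Group_Action" "HOL-Algebra.Ring"
begin

section \<open>Finite \<open>G\<close>-sets\<close>

text \<open>A \<open>G\<close>-set is an underlying set together with an action map.\<close>

type_synonym ('g, 'x) gset = "'x set \<times> ('g \<Rightarrow> 'x \<Rightarrow> 'x)"

definition finite_gset :: "('g, 'm) monoid_scheme \<Rightarrow> ('g, 'x) gset \<Rightarrow> bool" where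
  "finite_gset G X \<longleftrightarrow> finite (fst X) \<and> group_action G (fst X) (snd X)"

definition gset_iso :: "('g, 'm) monoid_scheme \<Rightarrow> ('g, 'x) gset \<Rightarrow> ('g, 'y) gset \<Rightarrow> bool" where
  "gset_iso G X Y \<longleftrightarrow>
     (\<exists>f. bij_betw f (fst X) (fst Y) \<and>
          (\<forall>g\<in>carrier G. \<forall>x\<in>fst X. f (snd X g x) = snd Y g (f x)))"

definition gset_image :: "('x \<Rightarrow> 'y) \<Rightarrow> ('g, 'x) gset \<Rightarrow> ('g, 'y) gset" where
  "gset_image e X =
     (e ` fst X, \<lambda>g. \<lambda>y\<in>e ` fst X. e (snd X g (inv_into (fst X) e y)))"

definition gset_plus :: "('g, 'x) gset \<Rightarrow> ('g, 'y) gset \<Rightarrow> ('g, 'x + 'y) gset" where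
  "gset_plus X Y =
     (fst X <+> fst Y, \<lambda>g. \<lambda>z\<in>fst X <+> fst Y. map_sum (snd X g) (snd Y g) z)"

definition gset_times :: "('g, 'x) gset \<Rightarrow> ('g, 'y) gset \<Rightarrow> ('g, 'x \<times> 'y) gset" where
  "gset_times X Y =
     (fst X \<times> fst Y, \<lambda>g. \<lambda>z\<in>fst X \<times> fst Y. map_prod (snd X g) (snd Y g) z)"

definition gset_empty :: "('g, 'x) gset" where
  "gset_empty = ({}, \<lambda>g. \<lambda>x\<in>{}. x)"

definition gset_point :: "('g, nat) gset" where
  "gset_point = ({0}, \<lambda>g. \<lambda>x\<in>{0}. x)"

definition gset_fixed :: "'g set \<Rightarrow> ('g, 'x) gset \<Rightarrow> 'x set" where
  "gset_fixed H X = {x \<in> fst X. \<forall>h\<in>H. snd X h x = x}"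


section \<open>The Burnside ring\<close>

text \<open>
  Every finite \<open>G\<close>-set is isomorphic to one whose points are natural numbers, so the isomorphism
  classes of finite \<open>G\<close>-sets are represented by \<^typ>\<open>('g, nat) gset\<close>; disjoint unions and products
  are carried back to \<^typ>\<open>nat\<close> along \<^const>\<open>sum_encode\<close> and \<^const>\<open>prod_encode\<close>.
\<close>

definition gset_add :: "('g, nat) gset \<Rightarrow> ('g, nat) gset \<Rightarrow> ('g, nat) gset" where
  "gset_add X Y = gset_image sum_encode (gset_plus X Y)"

definition gset_mult :: "('g, nat) gset \<Rightarrow> ('g, nat) gset \<Rightarrow> ('g, nat) gset" where
  "gset_mult X Y = gset_image prod_encode (gset_times X Y)"

text \<open>
  Grothendieck construction: the pair \<open>(X, Y)\<close> stands for the virtual \<open>G\<close>-set \<open>[X] - [Y]\<close>.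
\<close>

type_synonym 'g virtual_gset = "('g, nat) gset \<times> ('g, nat) gset"

definition virtual_gsets :: "('g, 'm) monoid_scheme \<Rightarrow> 'g virtual_gset set" where
  "virtual_gsets G = {(X, Y). finite_gset G X \<and> finite_gset G Y}"

definition burnside_rel :: "('g, 'm) monoid_scheme \<Rightarrow> 'g virtual_gset rel" where
  "burnside_rel G =
     {((X, Y), (X', Y')). (X, Y) \<in> virtual_gsets G \<and> (X', Y') \<in> virtual_gsets G \<and>
        (\<exists>Z :: ('g, nat) gset. finite_gset G Z \<and>
           gset_iso G (gset_add (gset_add X Y') Z) (gset_add (gset_add X' Y) Z))}"

definition burnside_class ::
  "('g, 'm) monoid_scheme \<Rightarrow> ('g, nat) gset \<Rightarrow> ('g, nat) gset \<Rightarrow> 'g virtual_gset set" where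
  "burnside_class G X Y = burnside_rel G `` {(X, Y)}"

definition burnside_ring :: "('g, 'm) monoid_scheme \<Rightarrow> 'g virtual_gset set ring" where
  "burnside_ring G =
     \<lparr>carrier = virtual_gsets G // burnside_rel G,
      monoid.mult = \<lambda>a b. \<Union>(X, Y)\<in>a. \<Union>(X', Y')\<in>b.
        burnside_class G (gset_add (gset_mult X X') (gset_mult Y Y'))
                         (gset_add (gset_mult X Y') (gset_mult Y X')),
      one = burnside_class G gset_point gset_empty,
      zero = burnside_class G gset_empty gset_empty,
      add = \<lambda>a b. \<Union>(X, Y)\<in>a. \<Union>(X', Y')\<in>b.
        burnside_class G (gset_add X X') (gset_add Y Y')\<rparr>"

text \<open>\<open>mark b H\<close> is the number \<open>|b\<^sup>H|\<close>, i.e. \<open>|X\<^sup>H| - |Y\<^sup>H|\<close> for any \<open>(X, Y)\<close> representing \<open>b\<close>.\<close>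

definition mark :: "'g virtual_gset set \<Rightarrow> 'g set \<Rightarrow> int" where
  "mark b H =
     the_elem ((\<lambda>(X, Y). int (card (gset_fixed H X)) - int (card (gset_fixed H Y))) ` b)"

text \<open>Restricting the action to \<open>H\<close> does not change the action map, only the acting group.\<close>

definition burnside_res ::
  "('g, 'm) monoid_scheme \<Rightarrow> 'g set \<Rightarrow> 'g virtual_gset set \<Rightarrow> 'g virtual_gset set" where
  "burnside_res G H b = (\<Union>(X, Y)\<in>b. burnside_class (G\<lparr>carrier := H\<rparr>) X Y)"


subsection \<open>The action of outer automorphisms\<close>

definition gset_twist ::
  "('g, 'm) monoid_scheme \<Rightarrow> ('g \<Rightarrow> 'g) \<Rightarrow> ('g, 'x) gset \<Rightarrow> ('g, 'x) gset" where
  "gset_twist G \<alpha> X = (fst X, \<lambda>g. snd X (inv_into (carrier G) \<alpha> g))"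

definition burnside_aut ::
  "('g, 'm) monoid_scheme \<Rightarrow> ('g \<Rightarrow> 'g) \<Rightarrow> 'g virtual_gset set \<Rightarrow> 'g virtual_gset set" where
  "burnside_aut G \<alpha> b = (\<Union>(X, Y)\<in>b. burnside_class G (gset_twist G \<alpha> X) (gset_twist G \<alpha> Y))"

text \<open>
  An element of \<open>Out(G)\<close> is a coset of \<open>Inn(G)\<close> in \<open>Aut(G)\<close>; it acts through any of its members,
  since inner automorphisms act trivially.
\<close>

definition burnside_out ::
  "('g, 'm) monoid_scheme \<Rightarrow> ('g \<Rightarrow> 'g) set \<Rightarrow> 'g virtual_gset set \<Rightarrow> 'g virtual_gset set" where
  "burnside_out G C b = the_elem ((\<lambda>\<alpha>. burnside_aut G \<alpha> b) ` C)"

definition burnside_fixed ::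
  "('g, 'm) monoid_scheme \<Rightarrow> ('g \<Rightarrow> 'g) set set \<Rightarrow> 'g virtual_gset set set" where
  "burnside_fixed G \<Gamma> = {b \<in> carrier (burnside_ring G). \<forall>C\<in>\<Gamma>. burnside_out G C b = b}"


section \<open>Fusion systems\<close>

definition finite_p_group :: "nat \<Rightarrow> ('a, 'm) monoid_scheme \<Rightarrow> bool" where
  "finite_p_group p S \<longleftrightarrow> group S \<and> finite (carrier S) \<and> (\<exists>n. order S = p ^ n)"

definition conj_map :: "('a, 'm) monoid_scheme \<Rightarrow> 'a set \<Rightarrow> 'a \<Rightarrow> 'a \<Rightarrow> 'a" where
  "conj_map S P g = (\<lambda>x\<in>P. g \<otimes>\<^bsub>S\<^esub> x \<otimes>\<^bsub>S\<^esub> inv\<^bsub>S\<^esub> g)"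

definition Hom_grp :: "('a, 'm) monoid_scheme \<Rightarrow> 'a set \<Rightarrow> 'a set \<Rightarrow> ('a \<Rightarrow> 'a) set" where
  "Hom_grp S P Q = {conj_map S P g | g. g \<in> carrier S \<and> conj_map S P g ` P \<subseteq> Q}"

abbreviation Aut_grp :: "('a, 'm) monoid_scheme \<Rightarrow> 'a set \<Rightarrow> ('a \<Rightarrow> 'a) set" where
  "Aut_grp S P \<equiv> Hom_grp S P P"

abbreviation Inn_grp :: "('a, 'm) monoid_scheme \<Rightarrow> 'a set \<Rightarrow> ('a \<Rightarrow> 'a) set" where
  "Inn_grp S P \<equiv> Hom_grp (S\<lparr>carrier := P\<rparr>) P P"

text \<open>
  A category on the subgroups of \<open>S\<close> is given by its hom sets \<open>F P Q\<close>; a morphism with source \<open>P\<close> is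
  a function that is \<^const>\<open>undefined\<close> outside \<open>P\<close>. The values of \<open>F\<close> at sets that are not subgroups
  carry no meaning.
\<close>

type_synonym 'a homs = "'a set \<Rightarrow> 'a set \<Rightarrow> ('a \<Rightarrow> 'a) set"

definition Iso_fus :: "'a homs \<Rightarrow> 'a set \<Rightarrow> 'a set \<Rightarrow> ('a \<Rightarrow> 'a) set" where
  "Iso_fus F P Q =
     {\<phi> \<in> F P Q. \<exists>\<psi>\<in>F Q P. compose P \<psi> \<phi> = (\<lambda>x\<in>P. x) \<and> compose Q \<phi> \<psi> = (\<lambda>x\<in>Q. x)}"

locale fusion_system =
  fixes S :: "('a, 'm) monoid_scheme" and F :: "'a homs"
  assumes morphism:
      "\<And>P Q. \<lbrakk>subgroup P S; subgroup Q S\<rbrakk> \<Longrightarrow>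
         F P Q \<subseteq> {\<phi> \<in> hom (S\<lparr>carrier := P\<rparr>) (S\<lparr>carrier := Q\<rparr>). inj_on \<phi> P \<and> \<phi> \<in> extensional P}"
    and ident: "\<And>P. subgroup P S \<Longrightarrow> (\<lambda>x\<in>P. x) \<in> F P P"
    and comp:
      "\<And>P Q R \<phi> \<psi>. \<lbrakk>subgroup P S; subgroup Q S; subgroup R S; \<phi> \<in> F P Q; \<psi> \<in> F Q R\<rbrakk> \<Longrightarrow>
         compose P \<psi> \<phi> \<in> F P R"
    and conj: "\<And>P Q. \<lbrakk>subgroup P S; subgroup Q S\<rbrakk> \<Longrightarrow> Hom_grp S P Q \<subseteq> F P Q"
    and factor:
      "\<And>P Q \<phi>. \<lbrakk>subgroup P S; subgroup Q S; \<phi> \<in> F P Q\<rbrakk> \<Longrightarrow>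
         \<exists>R. subgroup R S \<and> R \<subseteq> Q \<and> (\<exists>\<psi>\<in>Iso_fus F P R. \<phi> = compose P (\<lambda>x\<in>R. x) \<psi>)"

definition F_conj :: "('a, 'm) monoid_scheme \<Rightarrow> 'a homs \<Rightarrow> 'a set \<Rightarrow> 'a set \<Rightarrow> bool" where
  "F_conj S F P Q \<longleftrightarrow> subgroup P S \<and> subgroup Q S \<and> Iso_fus F P Q \<noteq> {}"

text \<open>The underlying multiplication of \<^const>\<open>AutoGroup\<close> is composition.\<close>

definition Aut_fus :: "('a, 'm) monoid_scheme \<Rightarrow> 'a homs \<Rightarrow> 'a set \<Rightarrow> ('a \<Rightarrow> 'a) monoid" where
  "Aut_fus S F P = AutoGroup (S\<lparr>carrier := P\<rparr>)\<lparr>carrier := F P P\<rparr>"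

definition Out_fus :: "('a, 'm) monoid_scheme \<Rightarrow> 'a homs \<Rightarrow> 'a set \<Rightarrow> ('a \<Rightarrow> 'a) set monoid" where
  "Out_fus S F P = Aut_fus S F P Mod Inn_grp S P"

definition sylow_subgroup :: "nat \<Rightarrow> 'a set \<Rightarrow> ('a, 'm) monoid_scheme \<Rightarrow> bool" where
  "sylow_subgroup p H G \<longleftrightarrow> subgroup H G \<and> card H = p ^ multiplicity p (order G)"

definition fully_automized ::
  "nat \<Rightarrow> ('a, 'm) monoid_scheme \<Rightarrow> 'a homs \<Rightarrow> 'a set \<Rightarrow> bool" where
  "fully_automized p S F P \<longleftrightarrow> sylow_subgroup p (Aut_grp S P) (Aut_fus S F P)"

definition extender ::
  "('a, 'm) monoid_scheme \<Rightarrow> 'a set \<Rightarrow> 'a set \<Rightarrow> ('a \<Rightarrow> 'a) \<Rightarrow> 'a set" where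
  "extender S Q P \<phi> =
     {g \<in> normalizer S Q.
        (\<lambda>x\<in>P. \<phi> (conj_map S Q g (inv_into Q \<phi> x))) \<in> Aut_grp S P}"

definition receptive :: "('a, 'm) monoid_scheme \<Rightarrow> 'a homs \<Rightarrow> 'a set \<Rightarrow> bool" where
  "receptive S F P \<longleftrightarrow>
     (\<forall>Q. \<forall>\<phi>\<in>Iso_fus F Q P. subgroup Q S \<longrightarrow>
        (\<exists>R. subgroup R S \<and> (\<exists>\<psi>\<in>F (extender S Q P \<phi>) R. \<forall>x\<in>Q. \<psi> x = \<phi> x)))"

definition saturated :: "nat \<Rightarrow> ('a, 'm) monoid_scheme \<Rightarrow> 'a homs \<Rightarrow> bool" where
  "saturated p S F \<longleftrightarrow>
     (\<forall>P. subgroup P S \<longrightarrow> (\<exists>Q. F_conj S F P Q \<and> fully_automized p S F Q \<and> receptive S F Q))"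

definition centralizer :: "('a, 'm) monoid_scheme \<Rightarrow> 'a set \<Rightarrow> 'a set" where
  "centralizer G A = {g \<in> carrier G. \<forall>x\<in>A. g \<otimes>\<^bsub>G\<^esub> x = x \<otimes>\<^bsub>G\<^esub> g}"

definition F_centric :: "('a, 'm) monoid_scheme \<Rightarrow> 'a homs \<Rightarrow> 'a set \<Rightarrow> bool" where
  "F_centric S F P \<longleftrightarrow> (\<forall>Q. F_conj S F P Q \<longrightarrow> centralizer S Q \<subseteq> Q)"

definition fully_normalized :: "('a, 'm) monoid_scheme \<Rightarrow> 'a homs \<Rightarrow> 'a set \<Rightarrow> bool" where
  "fully_normalized S F P \<longleftrightarrow>
     (\<forall>Q. F_conj S F P Q \<longrightarrow> card (normalizer S P) \<ge> card (normalizer S Q))"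

definition strongly_embedded :: "nat \<Rightarrow> 'a set \<Rightarrow> ('a, 'm) monoid_scheme \<Rightarrow> bool" where
  "strongly_embedded p H G \<longleftrightarrow>
     subgroup H G \<and> H \<noteq> carrier G \<and> p dvd card H \<and>
     (\<forall>x\<in>carrier G - H. \<not> p dvd card (H \<inter> (x <#\<^bsub>G\<^esub> H #>\<^bsub>G\<^esub> inv\<^bsub>G\<^esub> x)))"

definition F_essential :: "nat \<Rightarrow> ('a, 'm) monoid_scheme \<Rightarrow> 'a homs \<Rightarrow> 'a set \<Rightarrow> bool" where
  "F_essential p S F R \<longleftrightarrow>
     subgroup R S \<and> F_centric S F R \<and> fully_normalized S F R \<and>
     (\<exists>H. strongly_embedded p H (Out_fus S F R))"

definition burnside_fusion :: "('a, 'm) monoid_scheme \<Rightarrow> 'a homs \<Rightarrow> 'a virtual_gset set set" where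
  "burnside_fusion S F =
     {a \<in> carrier (burnside_ring S). \<forall>P Q. F_conj S F P Q \<longrightarrow> mark a P = mark a Q}"

end

theory Submission
  imports Defs "HOL-Algebra.Sylow"
begin

text \<open>
  A class in the Burnside ring is determined by its marks, so the restriction of \<open>b\<close> to \<open>P\<close> is
  \<open>Out\<^sub>F(P)\<close>-invariant iff \<open>|b\<^sup>Q| = |b\<^bsup>\<alpha>(Q)\<^esup>|\<close> for all \<open>Q \<le> P\<close> and \<open>\<alpha> \<in> Aut\<^sub>F(P)\<close>. By the factorization
  axiom this follows from invariance of the marks under \<open>F\<close>-conjugacy. The converse is Alperin's
  fusion theorem, proved for the function \<open>m(Q) = |b\<^sup>Q|\<close> by induction on the index of \<open>P\<close>: move \<open>P\<close> to
  a fully automized receptive conjugate \<open>R\<close> by a morphism that extends to \<open>N\<^sub>S(P)\<close>, where the induction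
  hypothesis applies. The remaining automorphisms of \<open>R\<close> preserve \<open>m\<close> because those that do form a
  subgroup whose image in \<open>Out\<^sub>F(R)\<close> would be strongly \<open>p\<close>-embedded if it were proper.
\<close>

text \<open>Saturation gives information only about the conjugate \<open>R\<close> that it supplies,
  not about \<open>P\<close> itself. So both \<open>P\<close> and its image are mapped onto the same
  \<open>R\<close>, and a morphism on \<open>P\<close> is judged by comparing these two maps. A map
  onto \<open>R\<close> extends to the normalizer only after a correction by an automorphism of
  \<open>R\<close>, which is why those automorphisms must be settled before arbitrary morphisms.
  Strong embedding records where extension fails. An automorphism that carries a non-inner element
  of \<open>Aut_grp S R\<close> into \<open>Aut_grp S R\<close> has an extender larger than
  \<open>R\<close>, so it extends and preserves \<open>m\<close> by induction. An automorphism
  outside the \<open>m\<close>-preserving subgroup therefore carries no such element, and this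
  forces that subgroup and its conjugate to meet, modulo \<open>Inn_grp S R\<close>, in a group of
  order prime to \<open>p\<close>. On the ring side, the stabilizing summand of the Grothendieck
  relation cancels from all marks, while equal marks already produce an isomorphism of
  \<open>G\<close>-sets. The relation thus becomes a family of integer equations, to which every
  question of well-definedness reduces.\<close>

section \<open>Finite group actions and the mark homomorphism\<close>

text \<open>Weaker than \<open>group_action\<close>, whose maps must be extensional on
  \<open>E\<close>: here the same \<open>\<phi>\<close> still acts after an orbit has been removed
  from \<open>E\<close>, as the induction on \<open>card E\<close> requires.\<close>

definition acts_on :: "('g, 'm) monoid_scheme \<Rightarrow> 'x set \<Rightarrow> ('g \<Rightarrow> 'x \<Rightarrow> 'x) \<Rightarrow> bool" where
  "acts_on G E \<phi> \<longleftrightarrow>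
     (\<forall>g\<in>carrier G. \<forall>x\<in>E. \<phi> g x \<in> E) \<and> (\<forall>x\<in>E. \<phi> \<one>\<^bsub>G\<^esub> x = x) \<and>
     (\<forall>g\<in>carrier G. \<forall>h\<in>carrier G. \<forall>x\<in>E. \<phi> (g \<otimes>\<^bsub>G\<^esub> h) x = \<phi> g (\<phi> h x))"

lemma acts_onD:
  assumes "acts_on G E \<phi>"
  shows "\<And>g x. g \<in> carrier G \<Longrightarrow> x \<in> E \<Longrightarrow> \<phi> g x \<in> E"
    and "\<And>x. x \<in> E \<Longrightarrow> \<phi> \<one>\<^bsub>G\<^esub> x = x"
    and "\<And>g h x. g \<in> carrier G \<Longrightarrow> h \<in> carrier G \<Longrightarrow> x \<in> E \<Longrightarrow>
           \<phi> (g \<otimes>\<^bsub>G\<^esub> h) x = \<phi> g (\<phi> h x)"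
  using assms by (auto simp: acts_on_def)

lemma equivariant_bij_card_fixed:
  assumes "bij_betw f E E'"
    and "\<And>h x. h \<in> H \<Longrightarrow> x \<in> E \<Longrightarrow> \<phi> h x \<in> E"
    and "\<And>h x. h \<in> H \<Longrightarrow> x \<in> E \<Longrightarrow> f (\<phi> h x) = \<phi>' h (f x)"
  shows "card {x \<in> E. \<forall>h\<in>H. \<phi> h x = x} = card {x \<in> E'. \<forall>h\<in>H. \<phi>' h x = x}"
proof (rule bij_betw_same_card)
  have inj: "inj_on f E" and E': "E' = f ` E"
    using assms(1) by (auto simp: bij_betw_def)
  have "f ` {x \<in> E. \<forall>h\<in>H. \<phi> h x = x} = {x \<in> E'. \<forall>h\<in>H. \<phi>' h x = x}"
  proof -
    have "\<phi>' h (f x) = f x \<longleftrightarrow> \<phi> h x = x" if "h \<in> H" "x \<in> E" for h x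
      using assms(2,3) inj that by (metis inj_onD)
    then show ?thesis unfolding E' by auto
  qed
  then show "bij_betw f {x \<in> E. \<forall>h\<in>H. \<phi> h x = x} {x \<in> E'. \<forall>h\<in>H. \<phi>' h x = x}"
    using inj by (auto simp: bij_betw_def intro: inj_on_subset)
qed

context group
begin

lemma inv_mult_cancel:
  "x \<in> carrier G \<Longrightarrow> y \<in> carrier G \<Longrightarrow> x \<otimes> (inv x \<otimes> y) = y"
  "x \<in> carrier G \<Longrightarrow> y \<in> carrier G \<Longrightarrow> inv x \<otimes> (x \<otimes> y) = y"
  by (simp_all flip: m_assoc)

lemma acts_on_inv:
  assumes "acts_on G E \<phi>" "g \<in> carrier G" "x \<in> E"
  shows "\<phi> (inv g) (\<phi> g x) = x" and "\<phi> g (\<phi> (inv g) x) = x"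
  using assms acts_onD[OF assms(1)] by (metis inv_closed l_inv, metis inv_closed r_inv)

text \<open>Restricting each map to \<open>E\<close> restores extensionality, which gives access to
  the theory of orbits and stabilizers.\<close>

lemma acts_on_group_action:
  assumes "acts_on G E \<phi>"
  shows "group_action G E (\<lambda>g. restrict (\<phi> g) E)"
proof -
  note D = acts_onD[OF assms] and I = acts_on_inv[OF assms]
  have "restrict (\<phi> g) E \<in> Bij E" if "g \<in> carrier G" for g
  proof -
    have "bij_betw (\<phi> g) E E"
      using that D(1) I by (intro bij_betw_byWitness[where f' = "\<phi> (inv g)"]) auto
    then show ?thesis
      unfolding Bij_def by (auto cong: bij_betw_cong)
  qed
  moreover have "restrict (\<phi> (g \<otimes> h)) E = compose E (restrict (\<phi> g) E) (restrict (\<phi> h) E)"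
    if "g \<in> carrier G" "h \<in> carrier G" for g h
    using that D by (auto simp: compose_def)
  ultimately show ?thesis
    unfolding group_action_def group_hom_def group_hom_axioms_def hom_def
    using is_group group_BijGroup by (auto simp: BijGroup_def)
qed

lemma group_action_acts_on: "group_action G E \<phi> \<Longrightarrow> acts_on G E \<phi>"
proof -
  assume act: "group_action G E \<phi>"
  have "\<phi> \<one> x = x" if "x \<in> E" for x
    using group_action.id_eq_one[OF act] that by (metis restrict_apply')
  then show ?thesis
    unfolding acts_on_def
    using group_action.composition_rule[OF act] group_action.element_image[OF act] by blast
qed

lemma acts_on_stabilizer_subgroup:
  assumes "acts_on G E \<phi>" "x \<in> E"
  shows "subgroup (stabilizer G \<phi> x) G"
proof -
  have "stabilizer G (\<lambda>g. restrict (\<phi> g) E) x = stabilizer G \<phi> x"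
    using assms by (auto simp: stabilizer_def)
  then show ?thesis
    using group_action.stabilizer_subgroup[OF acts_on_group_action[OF assms(1)] assms(2)] by simp
qed

lemma acts_on_Diff_orbit:
  assumes "acts_on G E \<phi>" "x \<in> E"
  shows "acts_on G (E - orbit G \<phi> x) \<phi>"
proof -
  note D = acts_onD[OF assms(1)] and I = acts_on_inv[OF assms(1)]
  have "\<phi> g y \<notin> orbit G \<phi> x" if "g \<in> carrier G" "y \<in> E" "y \<notin> orbit G \<phi> x" for g y
  proof
    assume "\<phi> g y \<in> orbit G \<phi> x"
    then obtain h where h: "h \<in> carrier G" "\<phi> g y = \<phi> h x"
      by (auto simp: orbit_def)
    then have "y = \<phi> (inv g \<otimes> h) x"
      using that I D assms(2) by (metis inv_closed)
    then have "y \<in> orbit G \<phi> x"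
      unfolding orbit_def using h(1) that(1) by blast
    with that show False by simp
  qed
  then show ?thesis
    using D unfolding acts_on_def by auto
qed

text \<open>The map sends \<open>\<phi> g x\<close> to \<open>\<phi>' g y\<close>. It is well
  defined and injective because \<open>\<phi> g x = \<phi> h x\<close> says exactly that
  \<open>inv h \<otimes> g\<close> stabilizes \<open>x\<close>, a condition that reads the same on
  both sides.\<close>

lemma equal_stabilizers_orbit_iso:
  assumes "acts_on G E \<phi>" "acts_on G E' \<phi>'" "x \<in> E" "y \<in> E'"
    and "stabilizer G \<phi> x = stabilizer G \<phi>' y"
  obtains f where "bij_betw f (orbit G \<phi> x) (orbit G \<phi>' y)"
    "\<And>g z. g \<in> carrier G \<Longrightarrow> z \<in> orbit G \<phi> x \<Longrightarrow> f (\<phi> g z) = \<phi>' g (f z)"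
proof -
  note D = acts_onD[OF assms(1)] and D' = acts_onD[OF assms(2)]
  have eq: "\<phi> g x = \<phi> h x \<longleftrightarrow> \<phi>' g y = \<phi>' h y"
    if "g \<in> carrier G" "h \<in> carrier G" for g h
  proof -
    have "\<phi> g x = \<phi> h x \<longleftrightarrow> inv h \<otimes> g \<in> stabilizer G \<phi> x"
      unfolding stabilizer_def using that D acts_on_inv[OF assms(1)] assms(3)
      by (simp) metis
    moreover have "\<phi>' g y = \<phi>' h y \<longleftrightarrow> inv h \<otimes> g \<in> stabilizer G \<phi>' y"
      unfolding stabilizer_def using that D' acts_on_inv[OF assms(2)] assms(4)
      by (simp) metis
    ultimately show ?thesis using assms(5) by simp
  qed
  define f where "f z = \<phi>' (SOME g. g \<in> carrier G \<and> \<phi> g x = z) y" for z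
  have f: "f (\<phi> g x) = \<phi>' g y" if "g \<in> carrier G" for g
  proof -
    have "(SOME h. h \<in> carrier G \<and> \<phi> h x = \<phi> g x) \<in> carrier G \<and>
        \<phi> (SOME h. h \<in> carrier G \<and> \<phi> h x = \<phi> g x) x = \<phi> g x"
      by (rule someI[of _ g]) (use that in simp)
    then show ?thesis
      unfolding f_def using eq that by blast
  qed
  show ?thesis
  proof
    show "bij_betw f (orbit G \<phi> x) (orbit G \<phi>' y)"
      unfolding bij_betw_def orbit_def inj_on_def using f eq by (auto simp: image_iff) metis
    show "f (\<phi> g z) = \<phi>' g (f z)" if "g \<in> carrier G" "z \<in> orbit G \<phi> x" for g z
    proof -
      from that obtain h where h: "h \<in> carrier G" "z = \<phi> h x"
        by (auto simp: orbit_def)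
      then have "f (\<phi> g z) = f (\<phi> (g \<otimes> h) x)"
        using D(3) that assms(3) by simp
      also have "\<dots> = \<phi>' g (f z)"
        using f h that D'(3) assms(4) by simp
      finally show ?thesis .
    qed
  qed
qed

text \<open>
  A point whose stabilizer \<open>H\<close> is of maximal order is matched with a point fixed by \<open>H\<close> on the other
  side, which then has the same stabilizer; removing the two orbits preserves the hypothesis.
\<close>

theorem acts_on_iso_if_fixed_points_eq:
  assumes "finite (carrier G)"
    and "finite E" "finite E'" "acts_on G E \<phi>" "acts_on G E' \<phi>'"
    and "\<And>H. subgroup H G \<Longrightarrow>
           card {x \<in> E. \<forall>h\<in>H. \<phi> h x = x} = card {x \<in> E'. \<forall>h\<in>H. \<phi>' h x = x}"
  shows "\<exists>f. bij_betw f E E' \<and> (\<forall>g\<in>carrier G. \<forall>x\<in>E. f (\<phi> g x) = \<phi>' g (f x))"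
  using assms(2-)
proof (induction "card E" arbitrary: E E' rule: less_induct)
  case less
  note D = acts_onD[OF less.prems(3)] and D' = acts_onD[OF less.prems(4)]
  have eqfix: "(\<exists>x\<in>E. \<forall>h\<in>H. \<phi> h x = x) \<longleftrightarrow> (\<exists>x\<in>E'. \<forall>h\<in>H. \<phi>' h x = x)" if "subgroup H G" for H
  proof -
    have fin: "finite {x \<in> E. \<forall>h\<in>H. \<phi> h x = x}" "finite {x \<in> E'. \<forall>h\<in>H. \<phi>' h x = x}"
      using less.prems(1,2) by auto
    have "{x \<in> E. \<forall>h\<in>H. \<phi> h x = x} = {} \<longleftrightarrow> {x \<in> E'. \<forall>h\<in>H. \<phi>' h x = x} = {}"
      using less.prems(5)[OF that] less.prems(1,2)
      by (metis (no_types, lifting) card_eq_0_iff fin)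
    then show ?thesis by blast
  qed
  show ?case
  proof (cases "E = {}")
    case True
    \<comment> \<open>Every point is fixed by the trivial subgroup, so a point of \<open>E'\<close>
      would force one in \<open>E\<close>.\<close>
    have "E' = {}"
    proof (rule ccontr)
      assume "E' \<noteq> {}"
      then have "\<exists>x\<in>E'. \<forall>h\<in>{\<one>}. \<phi>' h x = x" using D'(2) by auto
      then show False using eqfix[OF triv_subgroup] True by blast
    qed
    then show ?thesis using True by (auto simp: bij_betw_def)
  next
    case False
    let ?st = "stabilizer G \<phi>" and ?st' = "stabilizer G \<phi>'"
    have finst: "finite (?st x)" "finite (?st' y)" for x y
      using assms(1) by (auto simp: stabilizer_def)
    obtain x where x: "x \<in> E" "\<And>z. z \<in> E \<Longrightarrow> card (?st z) \<le> card (?st x)"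
    proof -
      have "Max ((\<lambda>z. card (?st z)) ` E) \<in> (\<lambda>z. card (?st z)) ` E"
        using False less.prems(1) by (intro Max_in) auto
      then obtain x where "x \<in> E" "card (?st x) = Max ((\<lambda>z. card (?st z)) ` E)"
        by auto
      then show ?thesis
        using that less.prems(1) by simp
    qed
    have sub: "subgroup (?st x) G"
      using acts_on_stabilizer_subgroup[OF less.prems(3) x(1)] .
    obtain y where y: "y \<in> E'" "\<forall>h\<in>?st x. \<phi>' h y = y"
      using eqfix[OF sub] x(1) by (auto simp: stabilizer_def)
    have xy: "?st x \<subseteq> ?st' y" using y by (auto simp: stabilizer_def)
    have sub': "subgroup (?st' y) G"
      using acts_on_stabilizer_subgroup[OF less.prems(4) y(1)] .
    \<comment> \<open>Going back to \<open>E\<close> closes the chain \<open>?st x\<close>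
      \<subseteq> \<open>?st' y\<close> \<subseteq> \<open>?st z\<close>, which the maximality of
      \<open>card (?st x)\<close> collapses to equalities.\<close>
    obtain z where z: "z \<in> E" "\<forall>h\<in>?st' y. \<phi> h z = z"
      using eqfix[OF sub'] y(1) by (auto simp: stabilizer_def)
    have yz: "?st' y \<subseteq> ?st z" using z by (auto simp: stabilizer_def)
    have "card (?st' y) \<le> card (?st x)"
      using card_mono[OF finst(1) yz] x(2)[OF z(1)] by simp
    then have st: "?st x = ?st' y"
      using xy finst by (simp add: card_seteq)
    obtain f where f: "bij_betw f (orbit G \<phi> x) (orbit G \<phi>' y)"
      "\<And>g z. g \<in> carrier G \<Longrightarrow> z \<in> orbit G \<phi> x \<Longrightarrow> f (\<phi> g z) = \<phi>' g (f z)"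
      using equal_stabilizers_orbit_iso[OF less.prems(3,4) x(1) y(1) st] by blast
    let ?O = "orbit G \<phi> x" and ?O' = "orbit G \<phi>' y"
    have O: "?O \<subseteq> E" "?O' \<subseteq> E'" "x \<in> ?O"
      using D D' x(1) y(1) by (auto simp: orbit_def intro!: exI[of _ \<one>])
    have fixO: "card {z \<in> ?O. \<forall>h\<in>H. \<phi> h z = z} = card {z \<in> ?O'. \<forall>h\<in>H. \<phi>' h z = z}"
      if H: "subgroup H G" for H
    proof -
      have "\<phi> h z \<in> ?O" if h: "h \<in> H" and z: "z \<in> ?O" for h z
      proof -
        have hG: "h \<in> carrier G" using H h by (rule subgroup.mem_carrier)
        obtain k where k: "k \<in> carrier G" "z = \<phi> k x" using z by (auto simp: orbit_def)
        then have "\<phi> h z = \<phi> (h \<otimes> k) x" using D(3) hG x(1) by simp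
        then show ?thesis using hG k by (auto simp: orbit_def)
      qed
      then show ?thesis
        using f subgroup.mem_carrier[OF H] by (intro equivariant_bij_card_fixed) auto
    qed
    have "\<exists>f. bij_betw f (E - ?O) (E' - ?O') \<and>
        (\<forall>g\<in>carrier G. \<forall>x\<in>E - ?O. f (\<phi> g x) = \<phi>' g (f x))"
    proof (rule less.hyps)
      show "card (E - ?O) < card E"
        using O less.prems(1) x(1) by (intro psubset_card_mono) auto
      show "acts_on G (E - ?O) \<phi>" "acts_on G (E' - ?O') \<phi>'"
        by (intro acts_on_Diff_orbit less.prems(3,4) x(1) y(1))+
      fix H assume H: "subgroup H G"
      \<comment> \<open>Fixed points off the two orbits are counted by subtraction; the orbits,
        being isomorphic, remove equally many on each side.\<close>
      have *: "card {x \<in> A - B. P x} = card {x \<in> A. P x} - card {x \<in> B. P x}"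
        if "finite A" "B \<subseteq> A" for A B :: "'z set" and P
      proof -
        have "{x \<in> A - B. P x} = {x \<in> A. P x} - {x \<in> B. P x}" using that by auto
        moreover have "finite B" using that finite_subset by blast
        ultimately show ?thesis using that by (simp add: card_Diff_subset subset_iff)
      qed
      show "card {x \<in> E - ?O. \<forall>h\<in>H. \<phi> h x = x} = card {x \<in> E' - ?O'. \<forall>h\<in>H. \<phi>' h x = x}"
        using *[OF less.prems(1) O(1)] *[OF less.prems(2) O(2)] less.prems(5)[OF H] fixO[OF H] by simp
    qed (use less.prems in auto)
    then obtain f' where f': "bij_betw f' (E - ?O) (E' - ?O')"
        "\<And>g x. g\<in>carrier G \<Longrightarrow> x\<in>E - ?O \<Longrightarrow> f' (\<phi> g x) = \<phi>' g (f' x)"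
      by blast
    let ?h = "\<lambda>z. if z \<in> ?O then f z else f' z"
    have "bij_betw ?h (?O \<union> (E - ?O)) (?O' \<union> (E' - ?O'))"
      using f(1) f'(1) by (intro bij_betw_disjoint_Un) auto
    then have "bij_betw ?h E E'"
      using O by (simp add: Un_absorb1)
    moreover have "?h (\<phi> g z) = \<phi>' g (?h z)" if "g \<in> carrier G" "z \<in> E" for g z
    proof (cases "z \<in> ?O")
      case True
      then obtain k where k: "k \<in> carrier G" "z = \<phi> k x" by (auto simp: orbit_def)
      then have "\<phi> g z = \<phi> (g \<otimes> k) x" using D(3) that x(1) by simp
      then have "\<phi> g z \<in> ?O" using that k by (auto simp: orbit_def)
      then show ?thesis using f(2) True that by simp
    next
      case False
      then have "\<phi> g z \<notin> ?O"
        using acts_onD(1)[OF acts_on_Diff_orbit[OF less.prems(3) x(1)] that(1)] that(2) by blast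
      then show ?thesis using f'(2) False that by simp
    qed
    ultimately show ?thesis by blast
  qed
qed

end

section \<open>Disjoint unions of \<open>G\<close>-sets and their fixed points\<close>

lemma fst_gset_add: "fst (gset_add X Y) = sum_encode ` (fst X <+> fst Y)"
  by (simp add: gset_add_def gset_image_def gset_plus_def)

lemma snd_gset_add:
  "x \<in> fst X \<Longrightarrow> snd (gset_add X Y) g (sum_encode (Inl x)) = sum_encode (Inl (snd X g x))"
  "y \<in> fst Y \<Longrightarrow> snd (gset_add X Y) g (sum_encode (Inr y)) = sum_encode (Inr (snd Y g y))"
  by (simp_all add: gset_add_def gset_image_def gset_plus_def
      inv_into_f_f[OF inj_on_subset[OF inj_sum_encode subset_UNIV]] InlI InrI)

lemma gset_fixed_gset_add:
  "gset_fixed H (gset_add X Y) = sum_encode ` (gset_fixed H X <+> gset_fixed H Y)"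
  by (auto simp: gset_fixed_def fst_gset_add snd_gset_add sum_encode_eq Plus_def)

lemma card_gset_fixed_gset_add:
  assumes "finite (fst X)" "finite (fst Y)"
  shows "card (gset_fixed H (gset_add X Y)) = card (gset_fixed H X) + card (gset_fixed H Y)"
proof -
  have "finite (gset_fixed H X)" "finite (gset_fixed H Y)"
    using assms by (auto simp: gset_fixed_def)
  then show ?thesis
    unfolding gset_fixed_gset_add
    using card_image[OF inj_on_subset[OF inj_sum_encode subset_UNIV]] card_Plus by metis
qed

lemma finite_gset_add:
  "finite (fst X) \<Longrightarrow> finite (fst Y) \<Longrightarrow> finite (fst (gset_add X Y))"
  by (simp add: fst_gset_add)

lemma acts_on_gset_add:
  assumes "acts_on G (fst X) (snd X)" "acts_on G (fst Y) (snd Y)"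
  shows "acts_on G (fst (gset_add X Y)) (snd (gset_add X Y))"
proof -
  note A = acts_onD[OF assms(1)] acts_onD[OF assms(2)]
  have cases: "\<forall>z\<in>fst (gset_add X Y). P z"
    if "\<And>x. x \<in> fst X \<Longrightarrow> P (sum_encode (Inl x))" "\<And>y. y \<in> fst Y \<Longrightarrow> P (sum_encode (Inr y))" for P
    using that by (auto simp: fst_gset_add)
  show ?thesis
    unfolding acts_on_def
    by (intro conjI ballI[where A = "carrier G"] cases) (simp_all add: A snd_gset_add, simp_all add: A fst_gset_add InlI InrI)
qed

lemma finite_gset_empty: "group G \<Longrightarrow> finite_gset G gset_empty"
  using group.acts_on_group_action[of G "{}" "\<lambda>g x. x"]
  by (simp add: finite_gset_def gset_empty_def acts_on_def)

text \<open>The mark of one representing pair, as opposed to \<open>mark\<close>, which is the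
  common value over a whole class.\<close>

definition virtual_mark :: "'g virtual_gset \<Rightarrow> 'g set \<Rightarrow> int" where
  "virtual_mark v H = int (card (gset_fixed H (fst v))) - int (card (gset_fixed H (snd v)))"

lemma mark_eq_virtual_mark: "mark b H = the_elem ((\<lambda>v. virtual_mark v H) ` b)"
  unfolding mark_def virtual_mark_def by (simp add: case_prod_unfold)

section \<open>Burnside classes are determined by their marks\<close>

locale finite_group = group +
  assumes finite_carrier: "finite (carrier G)"
begin

lemma subgroup_finite_group:
  assumes "subgroup H G"
  shows "finite_group (G\<lparr>carrier := H\<rparr>)"
proof -
  interpret H: group "G\<lparr>carrier := H\<rparr>"
    using assms by (rule subgroup_imp_group)
  show ?thesis
    using finite_subset[OF subgroup.subset[OF assms] finite_carrier] by unfold_locales simp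
qed

lemma virtual_gsetsD:
  assumes "v \<in> virtual_gsets G"
  shows "finite (fst (fst v))" "finite (fst (snd v))"
    "acts_on G (fst (fst v)) (snd (fst v))" "acts_on G (fst (snd v)) (snd (snd v))"
  using assms group_action_acts_on unfolding virtual_gsets_def finite_gset_def by auto

text \<open>Equality of the marks at \<open>H\<close> is the equation of the numbers of
  \<open>H\<close>-fixed points on \<open>X + Y'\<close> and \<open>X' + Y\<close>; any summand
  \<open>Z\<close> adds the same amount to both sides. Hence an isomorphism gives equal marks, and
  conversely equal marks give an isomorphism with \<open>Z\<close> empty.\<close>

lemma burnside_rel_iff:
  "(v, w) \<in> burnside_rel G \<longleftrightarrow> v \<in> virtual_gsets G \<and> w \<in> virtual_gsets G \<and>
     (\<forall>H. subgroup H G \<longrightarrow> virtual_mark v H = virtual_mark w H)"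
proof (cases "v \<in> virtual_gsets G \<and> w \<in> virtual_gsets G")
  case True
  obtain X Y X' Y' where v: "v = (X, Y)" and w: "w = (X', Y')"
    by (metis surj_pair)
  note V = virtual_gsetsD[OF conjunct1[OF True], unfolded v fst_conv snd_conv]
    and W = virtual_gsetsD[OF conjunct2[OF True], unfolded w fst_conv snd_conv]
  let ?A = "\<lambda>Z. gset_add (gset_add X Y') Z" and ?B = "\<lambda>Z. gset_add (gset_add X' Y) Z"
  have eq: "card (gset_fixed H (?A Z)) = card (gset_fixed H (?B Z)) \<longleftrightarrow>
      virtual_mark v H = virtual_mark w H" if "finite (fst Z)" for Z H
    using that V W
    by (auto simp: card_gset_fixed_gset_add finite_gset_add virtual_mark_def v w)
  have "(\<exists>Z :: ('a, nat) gset. finite_gset G Z \<and> gset_iso G (?A Z) (?B Z)) \<longleftrightarrow>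
      (\<forall>H. subgroup H G \<longrightarrow> virtual_mark v H = virtual_mark w H)"
  proof (intro iffI allI impI)
    fix H assume H: "subgroup H G"
    assume "\<exists>Z :: ('a, nat) gset. finite_gset G Z \<and> gset_iso G (?A Z) (?B Z)"
    then obtain Z f where Z: "finite_gset G Z" and f: "bij_betw f (fst (?A Z)) (fst (?B Z))"
      "\<forall>g\<in>carrier G. \<forall>x\<in>fst (?A Z). f (snd (?A Z) g x) = snd (?B Z) g (f x)"
      unfolding gset_iso_def by blast
    have Z': "finite (fst Z)" "acts_on G (fst Z) (snd Z)"
      using Z group_action_acts_on unfolding finite_gset_def by auto
    have "acts_on G (fst (?A Z)) (snd (?A Z))"
      by (intro acts_on_gset_add V W Z')
    then have "card (gset_fixed H (?A Z)) = card (gset_fixed H (?B Z))"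
      unfolding gset_fixed_def
      using f subgroup.mem_carrier[OF H] acts_onD(1)[of G "fst (?A Z)" "snd (?A Z)"]
      by (intro equivariant_bij_card_fixed) auto
    then show "virtual_mark v H = virtual_mark w H"
      using eq[OF Z'(1)] by simp
  next
    assume marks: "\<forall>H. subgroup H G \<longrightarrow> virtual_mark v H = virtual_mark w H"
    let ?Z = "gset_empty :: ('a, nat) gset"
    have Z: "finite_gset G ?Z" using finite_gset_empty is_group by blast
    then have Z': "finite (fst ?Z)" "acts_on G (fst ?Z) (snd ?Z)"
      using group_action_acts_on unfolding finite_gset_def by auto
    have "gset_iso G (?A ?Z) (?B ?Z)"
      unfolding gset_iso_def
    proof (rule acts_on_iso_if_fixed_points_eq[OF finite_carrier])
      show "finite (fst (?A ?Z))" "finite (fst (?B ?Z))"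
        by (intro finite_gset_add V W Z')+
      show "acts_on G (fst (?A ?Z)) (snd (?A ?Z))" "acts_on G (fst (?B ?Z)) (snd (?B ?Z))"
        by (intro acts_on_gset_add V W Z')+
      show "card {x \<in> fst (?A ?Z). \<forall>h\<in>H. snd (?A ?Z) h x = x} =
          card {x \<in> fst (?B ?Z). \<forall>h\<in>H. snd (?B ?Z) h x = x}" if "subgroup H G" for H
        using eq[OF Z'(1), of H] marks that unfolding gset_fixed_def by blast
    qed
    with Z show "\<exists>Z :: ('a, nat) gset. finite_gset G Z \<and> gset_iso G (?A Z) (?B Z)"
      by blast
  qed
  then show ?thesis
    using True unfolding burnside_rel_def v w by simp
qed (auto simp: burnside_rel_def)

lemma mem_burnside_class_iff:
  "v \<in> virtual_gsets G \<Longrightarrow> w \<in> burnside_class G (fst v) (snd v) \<longleftrightarrow>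
     w \<in> virtual_gsets G \<and> (\<forall>H. subgroup H G \<longrightarrow> virtual_mark w H = virtual_mark v H)"
  unfolding burnside_class_def using burnside_rel_iff[of v w] by auto

lemma burnside_class_eqI:
  assumes "v \<in> virtual_gsets G" "w \<in> virtual_gsets G"
    and "\<And>H. subgroup H G \<Longrightarrow> virtual_mark v H = virtual_mark w H"
  shows "burnside_class G (fst v) (snd v) = burnside_class G (fst w) (snd w)"
  using assms by (intro Set.set_eqI) (simp add: mem_burnside_class_iff del: split_paired_All)

lemma carrier_burnside_ring:
  "carrier (burnside_ring G) = (\<lambda>v. burnside_class G (fst v) (snd v)) ` virtual_gsets G"
  unfolding burnside_ring_def burnside_class_def quotient_def by auto

lemma mark_burnside_class:
  assumes "v \<in> virtual_gsets G" "subgroup H G"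
  shows "mark (burnside_class G (fst v) (snd v)) H = virtual_mark v H"
proof -
  have "v \<in> burnside_class G (fst v) (snd v)"
    using assms mem_burnside_class_iff by blast
  then have "(\<lambda>w. virtual_mark w H) ` burnside_class G (fst v) (snd v) = {virtual_mark v H}"
    using assms by (auto simp: image_iff mem_burnside_class_iff simp del: split_paired_All split_paired_Ex)
  then show ?thesis
    unfolding mark_eq_virtual_mark by simp
qed

theorem burnside_ring_eqI:
  assumes "a \<in> carrier (burnside_ring G)" "b \<in> carrier (burnside_ring G)"
    and "\<And>H. subgroup H G \<Longrightarrow> mark a H = mark b H"
  shows "a = b"
proof -
  obtain v w where v: "v \<in> virtual_gsets G" "a = burnside_class G (fst v) (snd v)"
    and w: "w \<in> virtual_gsets G" "b = burnside_class G (fst w) (snd w)"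
    using assms(1,2) unfolding carrier_burnside_ring by blast
  then have "\<forall>H. subgroup H G \<longrightarrow> virtual_mark v H = virtual_mark w H"
    using assms(3) mark_burnside_class by simp
  then show ?thesis
    using burnside_class_eqI[OF v(1) w(1)] unfolding v(2) w(2) by blast
qed

text \<open>\<open>burnside_res\<close> and \<open>burnside_aut\<close> are unions over all
  representatives; once the summand \<open>T\<close> is constant on the class, the union is its
  value at any one of them.\<close>

lemma UN_burnside_class_eq:
  assumes "v \<in> virtual_gsets G"
    and "\<And>w. w \<in> burnside_class G (fst v) (snd v) \<Longrightarrow> T w = T v"
  shows "(\<Union>(X, Y)\<in>burnside_class G (fst v) (snd v). T (X, Y)) = T v"
proof -
  have "v \<in> burnside_class G (fst v) (snd v)"
    using assms mem_burnside_class_iff by blast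
  then show ?thesis using assms(2) by force
qed

section \<open>Restriction to a subgroup\<close>

lemma virtual_gsets_subgroup:
  assumes "subgroup P G" "v \<in> virtual_gsets G"
  shows "v \<in> virtual_gsets (G\<lparr>carrier := P\<rparr>)"
  using assms group_action.induced_action
  unfolding virtual_gsets_def finite_gset_def by auto

text \<open>Subgroups of \<open>P\<close> are subgroups of \<open>G\<close>, so representatives with
  equal marks over \<open>G\<close> keep equal marks over \<open>P\<close>.\<close>

lemma burnside_res_burnside_class:
  assumes "subgroup P G" "v \<in> virtual_gsets G"
  shows "burnside_res G P (burnside_class G (fst v) (snd v)) =
     burnside_class (G\<lparr>carrier := P\<rparr>) (fst v) (snd v)"
proof -
  interpret P: finite_group "G\<lparr>carrier := P\<rparr>"
    using subgroup_finite_group[OF assms(1)] .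
  have "burnside_class (G\<lparr>carrier := P\<rparr>) (fst w) (snd w) =
      burnside_class (G\<lparr>carrier := P\<rparr>) (fst v) (snd v)"
    if "w \<in> burnside_class G (fst v) (snd v)" for w
  proof -
    have w: "w \<in> virtual_gsets G" "\<And>H. subgroup H G \<Longrightarrow> virtual_mark w H = virtual_mark v H"
      using that mem_burnside_class_iff[OF assms(2)] by auto
    have "virtual_mark w H = virtual_mark v H" if "subgroup H (G\<lparr>carrier := P\<rparr>)" for H
      using w(2) that assms(1) incl_subgroup by blast
    then show ?thesis
      using virtual_gsets_subgroup[OF assms(1)] w(1) assms(2) by (intro P.burnside_class_eqI)
  qed
  from UN_burnside_class_eq[OF assms(2), of "\<lambda>w. burnside_class (G\<lparr>carrier := P\<rparr>) (fst w) (snd w)"] this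
  show ?thesis unfolding burnside_res_def by simp
qed

lemma burnside_res_closed:
  assumes "subgroup P G" "b \<in> carrier (burnside_ring G)"
  shows "burnside_res G P b \<in> carrier (burnside_ring (G\<lparr>carrier := P\<rparr>))"
proof -
  interpret P: finite_group "G\<lparr>carrier := P\<rparr>"
    using subgroup_finite_group[OF assms(1)] .
  obtain v where v: "v \<in> virtual_gsets G" "b = burnside_class G (fst v) (snd v)"
    using assms(2) unfolding carrier_burnside_ring by blast
  show ?thesis
    using burnside_res_burnside_class[OF assms(1) v(1)] virtual_gsets_subgroup[OF assms(1) v(1)]
    unfolding v(2) P.carrier_burnside_ring by simp
qed

lemma mark_burnside_res:
  assumes "subgroup P G" "b \<in> carrier (burnside_ring G)" "subgroup Q G" "Q \<subseteq> P"
  shows "mark (burnside_res G P b) Q = mark b Q"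
proof -
  interpret P: finite_group "G\<lparr>carrier := P\<rparr>"
    using subgroup_finite_group[OF assms(1)] .
  obtain v where v: "v \<in> virtual_gsets G" "b = burnside_class G (fst v) (snd v)"
    using assms(2) unfolding carrier_burnside_ring by blast
  have "subgroup Q (G\<lparr>carrier := P\<rparr>)"
    using assms subgroup_incl by blast
  then show ?thesis
    unfolding v(2) burnside_res_burnside_class[OF assms(1) v(1)]
    using P.mark_burnside_class[OF virtual_gsets_subgroup[OF assms(1) v(1)]]
      mark_burnside_class[OF v(1) assms(3)] by simp
qed

section \<open>The action of automorphisms\<close>

lemma auto_inv_into:
  assumes "\<alpha> \<in> auto G"
  shows "inv_into (carrier G) \<alpha> \<in> hom G G"
    and "\<And>g. g \<in> carrier G \<Longrightarrow> \<alpha> (inv_into (carrier G) \<alpha> g) = g"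
    and "\<And>g. g \<in> carrier G \<Longrightarrow> inv_into (carrier G) \<alpha> (\<alpha> g) = g"
proof -
  have \<alpha>: "\<alpha> \<in> hom G G" "\<alpha> \<in> Bij (carrier G)"
    using assms by (auto simp: auto_def)
  \<comment> \<open>\<open>gset_twist\<close> uses the bare \<open>inv_into\<close>, which need not
    be extensional; it agrees with its restriction on the carrier, and \<open>hom\<close> looks no
    further.\<close>
  have "restrict (inv_into (carrier G) \<alpha>) (carrier G) \<in> hom G G"
    using restrict_inv_into_hom \<alpha> by blast
  then show "inv_into (carrier G) \<alpha> \<in> hom G G"
    by (auto simp: hom_def Pi_iff)
  show "\<alpha> (inv_into (carrier G) \<alpha> g) = g" "inv_into (carrier G) \<alpha> (\<alpha> g) = g"
    if "g \<in> carrier G" for g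
    using \<alpha>(2) that by (auto simp: Bij_def bij_betw_def f_inv_into_f inv_into_f_f)
qed

lemma gset_fixed_gset_twist:
  "gset_fixed H (gset_twist G \<alpha> X) = gset_fixed (inv_into (carrier G) \<alpha> ` H) X"
  by (simp add: gset_fixed_def gset_twist_def)

lemma virtual_gsets_twist:
  assumes "\<alpha> \<in> auto G" "v \<in> virtual_gsets G"
  shows "(gset_twist G \<alpha> (fst v), gset_twist G \<alpha> (snd v)) \<in> virtual_gsets G"
proof -
  have "group_action G E (\<lambda>g. \<phi> (inv_into (carrier G) \<alpha> g))" if "group_action G E \<phi>"
    for E and \<phi> :: "'a \<Rightarrow> nat \<Rightarrow> nat"
  proof -
    have "\<phi> \<circ> inv_into (carrier G) \<alpha> \<in> hom G (BijGroup E)"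
      using auto_inv_into(1)[OF assms(1)] that
      unfolding group_action_def group_hom_def group_hom_axioms_def by (auto simp: hom_def Pi_iff)
    then show ?thesis
      using that unfolding group_action_def group_hom_def group_hom_axioms_def by (simp add: comp_def)
  qed
  then show ?thesis
    using assms(2) unfolding virtual_gsets_def finite_gset_def gset_twist_def by auto
qed

text \<open>The mark of the twist at \<open>H\<close> is the original mark at the preimage of
  \<open>H\<close> under \<open>\<alpha>\<close>, again a subgroup, so twisting respects
  classes.\<close>

lemma burnside_aut_burnside_class:
  assumes "\<alpha> \<in> auto G" "v \<in> virtual_gsets G"
  shows "burnside_aut G \<alpha> (burnside_class G (fst v) (snd v)) =
     burnside_class G (gset_twist G \<alpha> (fst v)) (gset_twist G \<alpha> (snd v))"
proof -
  have "burnside_class G (gset_twist G \<alpha> (fst w)) (gset_twist G \<alpha> (snd w)) =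
      burnside_class G (gset_twist G \<alpha> (fst v)) (gset_twist G \<alpha> (snd v))"
    if "w \<in> burnside_class G (fst v) (snd v)" for w
  proof -
    have w: "w \<in> virtual_gsets G" "\<And>H. subgroup H G \<Longrightarrow> virtual_mark w H = virtual_mark v H"
      using that mem_burnside_class_iff[OF assms(2)] by auto
    interpret inv: group_hom G G "inv_into (carrier G) \<alpha>"
      by unfold_locales (rule auto_inv_into(1)[OF assms(1)])
    have "virtual_mark (gset_twist G \<alpha> (fst w), gset_twist G \<alpha> (snd w)) H =
        virtual_mark (gset_twist G \<alpha> (fst v), gset_twist G \<alpha> (snd v)) H" if "subgroup H G" for H
      using w(2)[OF inv.subgroup_img_is_subgroup[OF that]]
      by (simp add: virtual_mark_def gset_fixed_gset_twist)
    then show ?thesis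
      using burnside_class_eqI[OF virtual_gsets_twist[OF assms(1) w(1)] virtual_gsets_twist[OF assms]]
      by simp
  qed
  from UN_burnside_class_eq[OF assms(2),
      of "\<lambda>w. burnside_class G (gset_twist G \<alpha> (fst w)) (gset_twist G \<alpha> (snd w))"] this
  show ?thesis unfolding burnside_aut_def by simp
qed

lemma burnside_aut_closed:
  assumes "\<alpha> \<in> auto G" "b \<in> carrier (burnside_ring G)"
  shows "burnside_aut G \<alpha> b \<in> carrier (burnside_ring G)"
proof -
  obtain v where v: "v \<in> virtual_gsets G" "b = burnside_class G (fst v) (snd v)"
    using assms(2) unfolding carrier_burnside_ring by blast
  show ?thesis
    unfolding v(2) burnside_aut_burnside_class[OF assms(1) v(1)] carrier_burnside_ring
    by (intro image_eqI[OF _ virtual_gsets_twist[OF assms(1) v(1)]]) simp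
qed

lemma mark_burnside_aut:
  assumes "\<alpha> \<in> auto G" "b \<in> carrier (burnside_ring G)" "subgroup H G"
  shows "mark (burnside_aut G \<alpha> b) H = mark b (inv_into (carrier G) \<alpha> ` H)"
proof -
  obtain v where v: "v \<in> virtual_gsets G" "b = burnside_class G (fst v) (snd v)"
    using assms(2) unfolding carrier_burnside_ring by blast
  interpret inv: group_hom G G "inv_into (carrier G) \<alpha>"
    by unfold_locales (rule auto_inv_into(1)[OF assms(1)])
  have "mark (burnside_aut G \<alpha> b) H = virtual_mark (gset_twist G \<alpha> (fst v), gset_twist G \<alpha> (snd v)) H"
    using mark_burnside_class[OF virtual_gsets_twist[OF assms(1) v(1)] assms(3)]
    unfolding v(2) burnside_aut_burnside_class[OF assms(1) v(1)] by simp
  also have "\<dots> = virtual_mark v (inv_into (carrier G) \<alpha> ` H)"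
    by (simp add: virtual_mark_def gset_fixed_gset_twist)
  also have "\<dots> = mark b (inv_into (carrier G) \<alpha> ` H)"
    using mark_burnside_class[OF v(1) inv.subgroup_img_is_subgroup[OF assms(3)]] v(2) by simp
  finally show ?thesis .
qed

text \<open>Twisting naturally involves preimages under \<open>\<alpha>\<close>. As
  \<open>\<alpha>\<close> permutes the subgroups of \<open>G\<close>, they can be traded for images,
  the form that suits morphisms of a fusion system.\<close>

lemma burnside_aut_fixed_iff:
  assumes "\<alpha> \<in> auto G" "b \<in> carrier (burnside_ring G)"
  shows "burnside_aut G \<alpha> b = b \<longleftrightarrow> (\<forall>H. subgroup H G \<longrightarrow> mark b (\<alpha> ` H) = mark b H)"
proof -
  interpret \<alpha>: group_hom G G \<alpha>
    using assms(1) by unfold_locales (simp add: auto_def)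
  interpret inv: group_hom G G "inv_into (carrier G) \<alpha>"
    by unfold_locales (rule auto_inv_into(1)[OF assms(1)])
  have img: "\<alpha> ` inv_into (carrier G) \<alpha> ` H = H" "inv_into (carrier G) \<alpha> ` \<alpha> ` H = H"
    if "subgroup H G" for H
    using auto_inv_into(2,3)[OF assms(1)] subgroup.mem_carrier[OF that]
    by (force simp: image_image)+
  have "burnside_aut G \<alpha> b = b \<longleftrightarrow>
      (\<forall>H. subgroup H G \<longrightarrow> mark b (inv_into (carrier G) \<alpha> ` H) = mark b H)"
    using burnside_ring_eqI[OF burnside_aut_closed[OF assms] assms(2)] mark_burnside_aut[OF assms]
    by auto
  also have "\<dots> \<longleftrightarrow> (\<forall>H. subgroup H G \<longrightarrow> mark b (\<alpha> ` H) = mark b H)"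
    using img \<alpha>.subgroup_img_is_subgroup inv.subgroup_img_is_subgroup by metis
  finally show ?thesis .
qed

text \<open>Acting by \<open>g\<close> carries the points fixed by \<open>H\<close> onto those fixed
  by its conjugate, and \<open>inv g\<close> carries them back.\<close>

lemma card_gset_fixed_conj:
  assumes "acts_on G (fst X) (snd X)" "H \<subseteq> carrier G" "g \<in> carrier G"
  shows "card (gset_fixed ((\<lambda>x. g \<otimes> x \<otimes> inv g) ` H) X) = card (gset_fixed H X)"
proof -
  note D = acts_onD[OF assms(1)] and I = acts_on_inv[OF assms(1,3)]
  let ?c = "(\<lambda>x. g \<otimes> x \<otimes> inv g) ` H"
  have 1: "snd X g x \<in> gset_fixed ?c X" if "x \<in> gset_fixed H X" for x
    using that D I assms(2,3) unfolding gset_fixed_def by (auto simp: m_assoc subset_iff)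
  have 2: "snd X (inv g) x \<in> gset_fixed H X" if x: "x \<in> gset_fixed ?c X" for x
  proof -
    have "snd X h (snd X (inv g) x) = snd X (inv g) x" if "h \<in> H" for h
    proof -
      have h: "h \<in> carrier G" using that assms(2) by blast
      have "snd X (g \<otimes> h \<otimes> inv g) x = x" "x \<in> fst X"
        using x that unfolding gset_fixed_def by auto
      then have "snd X (inv g) x = snd X (inv g \<otimes> (g \<otimes> h \<otimes> inv g)) x"
        using D(3) h assms(3) by simp
      also have "inv g \<otimes> (g \<otimes> h \<otimes> inv g) = h \<otimes> inv g"
        using h assms(3) by (simp add: m_assoc inv_mult_cancel)
      finally show ?thesis
        using D(3) h assms(3) \<open>x \<in> fst X\<close> by simp
    qed
    then show ?thesis
      using D(1) x assms(3) unfolding gset_fixed_def by auto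
  qed
  have "bij_betw (snd X g) (gset_fixed H X) (gset_fixed ?c X)"
    using 1 2 I by (intro bij_betw_byWitness[where f' = "snd X (inv g)"]) (auto simp: gset_fixed_def)
  then show ?thesis
    by (rule bij_betw_same_card[symmetric])
qed

text \<open>This is why inner automorphisms act trivially on the Burnside ring.\<close>

lemma mark_conj:
  assumes "b \<in> carrier (burnside_ring G)" "subgroup H G" "g \<in> carrier G"
  shows "mark b ((\<lambda>x. g \<otimes> x \<otimes> inv g) ` H) = mark b H"
proof -
  obtain v where v: "v \<in> virtual_gsets G" "b = burnside_class G (fst v) (snd v)"
    using assms(1) unfolding carrier_burnside_ring by blast
  have "(\<lambda>x. g \<otimes> x \<otimes> inv g) ` H = g <# H #> inv g"
    by (auto simp: l_coset_def r_coset_def)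
  then have "subgroup ((\<lambda>x. g \<otimes> x \<otimes> inv g) ` H) G"
    using subgroup_conjugation_is_surj2[OF assms(3,2)] by simp
  then show ?thesis
    unfolding v(2) mark_burnside_class[OF v(1) assms(2)]
    using mark_burnside_class[OF v(1)] virtual_gsetsD[OF v(1)] subgroup.subset[OF assms(2)] assms(3)
    by (simp add: virtual_mark_def card_gset_fixed_conj)
qed

end

section \<open>Sylow subgroups and strongly embedded subgroups\<close>

context group
begin

text \<open>Orbit lengths divide \<open>p ^ n\<close>. Since they add up to a number prime to
  \<open>p\<close>, one of them is prime to \<open>p\<close> and hence equal to 1.\<close>

lemma p_group_acts_on_fixed_point:
  assumes "prime p" "order G = p ^ n" "acts_on G E \<phi>" "finite E" "\<not> p dvd card E"
  obtains x where "x \<in> E" "\<And>g. g \<in> carrier G \<Longrightarrow> \<phi> g x = x"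
proof -
  let ?\<phi> = "\<lambda>g. restrict (\<phi> g) E"
  interpret group_action G E ?\<phi>
    using acts_on_group_action[OF assms(3)] .
  have "card E = (\<Sum>A\<in>orbits G E ?\<phi>. card A)"
    using partition.disjoint_sum[OF orbit_partition assms(4), of "\<lambda>_. 1 :: nat"] by simp
  then obtain A where A: "A \<in> orbits G E ?\<phi>" "\<not> p dvd card A"
    using assms(5) by (metis dvd_sum)
  then obtain x where x: "x \<in> E" "A = orbit G ?\<phi> x"
    by (auto simp: orbits_def)
  have "card A dvd p ^ n"
    using orbit_stabilizer_theorem[OF x(1)] assms(2) x(2) by (metis dvd_triv_left)
  then have "card A = 1"
    using A(2) assms(1) by (metis divides_primepow_nat dvd_power gr0I power_0)
  then obtain y where "A = {y}"
    by (auto simp: card_1_singleton_iff)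
  then have "A = {x}"
    using orbit_refl[OF x(1)] x(2) by simp
  then have "\<phi> g x = x" if "g \<in> carrier G" for g
    using that x by (auto simp: orbit_def)
  with x(1) show ?thesis using that by blast
qed

text \<open>The inverse turns multiplication on the right into an action on the left.
  \<open>V\<close> acts through a homomorphism \<open>f\<close>, not just as a subgroup, because
  fusion systems will supply the conjugation map from \<open>normalizer S Q\<close> to
  \<open>Aut_fus S F R\<close>, which may have a kernel.\<close>

lemma acts_on_rcosets:
  assumes "group V" "f \<in> hom V G" "subgroup T G"
  shows "acts_on V (rcosets T) (\<lambda>v C. C #> inv (f v))"
proof -
  interpret V: group V by fact
  interpret f: group_hom V G f
    using assms(2) by unfold_locales
  have TG: "T \<subseteq> carrier G" using assms(3) by (rule subgroup.subset)
  have cases: "\<forall>C\<in>rcosets T. P C" if "\<And>a. a \<in> carrier G \<Longrightarrow> P (T #> a)" for P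
    using that by (auto simp: RCOSETS_def)
  show ?thesis
    unfolding acts_on_def
    by (intro conjI ballI[where A = "carrier V"] cases)
      (simp_all add: coset_mult_assoc TG rcosetsI inv_mult_group m_assoc)
qed

text \<open>The stabilizer of \<open>T #> a\<close> under right multiplication is the conjugate of
  \<open>T\<close> by \<open>inv a\<close>.\<close>

lemma rcoset_fixed_imp_conj_mem:
  assumes "subgroup T G" "a \<in> carrier G" "b \<in> carrier G" "(T #> a) #> inv b = T #> a"
  shows "a \<otimes> b \<otimes> inv a \<in> T"
proof -
  have TG: "T \<subseteq> carrier G" using assms(1) by (rule subgroup.subset)
  have "T #> (a \<otimes> b) = ((T #> a) #> inv b) #> b"
    using assms TG by (simp add: coset_mult_assoc)
  also have "\<dots> = T #> a"
    using assms(2,3) TG by (simp add: coset_mult_assoc m_assoc)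
  finally have "a \<otimes> b \<in> T #> a"
    using rcos_self[OF m_closed[OF assms(2,3)] assms(1)] by simp
  then obtain t where "t \<in> T" "a \<otimes> b = t \<otimes> a"
    by (auto simp: r_coset_def)
  then show ?thesis
    using assms TG by (auto simp: m_assoc)
qed

text \<open>Conjugation is injective and \<open>Q\<close> is finite, so mapping \<open>Q\<close>
  into itself already means mapping it onto itself.\<close>

lemma mem_normalizer_iff:
  assumes "finite Q" "Q \<subseteq> carrier G"
  shows "g \<in> normalizer G Q \<longleftrightarrow> g \<in> carrier G \<and> (\<forall>x\<in>Q. g \<otimes> x \<otimes> inv g \<in> Q)"
proof (cases "g \<in> carrier G")
  case True
  have img: "g <# Q #> inv g = (\<lambda>x. g \<otimes> x \<otimes> inv g) ` Q"
    by (auto simp: l_coset_def r_coset_def)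
  have "inj_on (\<lambda>x. g \<otimes> x \<otimes> inv g) Q"
    using True assms(2) by (auto simp: inj_on_def subset_iff)
  then have "(\<lambda>x. g \<otimes> x \<otimes> inv g) ` Q = Q \<longleftrightarrow> (\<forall>x\<in>Q. g \<otimes> x \<otimes> inv g \<in> Q)"
    using endo_inj_surj[OF assms(1), of "\<lambda>x. g \<otimes> x \<otimes> inv g"] by (auto simp: image_subset_iff)
  then show ?thesis
    using True assms(2) by (simp add: normalizer_def stabilizer_def img)
qed (simp add: normalizer_def stabilizer_def)

lemma normalizer_subgroup:
  assumes "Q \<subseteq> carrier G"
  shows "subgroup (normalizer G Q) G"
  unfolding normalizer_def
  using group_action.stabilizer_subgroup[OF action_by_conjugation_on_power_set] assms by blast

end

context finite_group
begin

text \<open>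
  The \<open>p\<close>-group \<open>V\<close> acts on the cosets of \<open>T\<close>, whose number is prime to \<open>p\<close>, so some coset is fixed.
\<close>

lemma sylow_conjugate:
  assumes "prime p" "group V" "order V = p ^ n" "f \<in> hom V G" "sylow_subgroup p T G"
  obtains g where "g \<in> carrier G" "\<And>v. v \<in> carrier V \<Longrightarrow> g \<otimes> f v \<otimes> inv g \<in> T"
proof -
  have T: "subgroup T G" "card T = p ^ multiplicity p (order G)"
    using assms(5) by (auto simp: sylow_subgroup_def)
  have "order G > 0"
    using finite_carrier by (simp add: order_gt_0_iff_finite)
  have "\<not> p dvd card (rcosets T)"
  proof
    assume "p dvd card (rcosets T)"
    then have "p * card T dvd card (rcosets T) * card T"
      by (rule mult_dvd_mono) simp
    then have "p ^ Suc (multiplicity p (order G)) dvd order G"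
      using lagrange[OF T(1)] by (simp only: T(2) power_Suc)
    then show False
      using \<open>order G > 0\<close> assms(1)
      by (metis gr_implies_not0 lessI not_prime_unit power_dvd_iff_le_multiplicity not_less)
  qed
  moreover have "finite (rcosets T)"
    using finite_carrier by (simp add: RCOSETS_def)
  ultimately obtain C where C: "C \<in> rcosets T" "\<And>v. v \<in> carrier V \<Longrightarrow> C #> inv (f v) = C"
    using group.p_group_acts_on_fixed_point[OF assms(2,1,3) acts_on_rcosets[OF assms(2,4) T(1)]]
    by blast
  then obtain g where g: "g \<in> carrier G" "C = T #> g"
    by (auto simp: RCOSETS_def)
  have "g \<otimes> f v \<otimes> inv g \<in> T" if "v \<in> carrier V" for v
    using rcoset_fixed_imp_conj_mem[OF T(1) g(1)] C(2)[OF that] g(2) hom_in_carrier[OF assms(4) that]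
    by simp
  with g(1) show ?thesis using that by blast
qed

text \<open>\<open>P\<close> acts on its cosets other than \<open>P\<close> itself. The index of
  \<open>P\<close> is divisible by \<open>p\<close>, so their number is prime to \<open>p\<close>
  and one of them, \<open>P #> g\<close>, is fixed; then \<open>g\<close> normalizes
  \<open>P\<close>.\<close>

lemma p_group_normalizer_grows:
  assumes "prime p" "order G = p ^ n" "subgroup P G" "P \<noteq> carrier G"
  obtains g where "g \<in> normalizer G P" "g \<notin> P"
proof -
  let ?P = "G\<lparr>carrier := P\<rparr>" and ?\<phi> = "\<lambda>v C. C #> inv v"
  interpret P: group ?P
    using assms(3) by (rule subgroup_imp_group)
  have PG: "P \<subseteq> carrier G" using assms(3) by (rule subgroup.subset)
  have fin: "finite P" using PG finite_carrier by (rule finite_subset)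
  have acts: "acts_on ?P (rcosets P) ?\<phi>"
    using acts_on_rcosets[OF P.is_group, of "\<lambda>v. v" P] assms(3) PG
    by (auto simp: hom_def Pi_iff subset_iff)
  have P: "P \<in> rcosets P"
    using assms(3) by (simp add: subgroup.subgroup_in_rcosets is_group)
  have eqP: "P #> v = P" if "v \<in> P" for v
    using that assms(3) coset_join2 PG by blast
  have "acts_on ?P (rcosets P - {P}) ?\<phi>"
  proof -
    have "C = P" if "C \<in> rcosets P" "v \<in> P" "C #> inv v = P" for C v
      using P.acts_on_inv(1)[OF acts, of v C] that m_inv_consistent[OF assms(3)]
        subgroup.m_inv_closed[OF assms(3)] eqP by simp
    then show ?thesis
      using acts unfolding acts_on_def by auto
  qed
  moreover obtain k where k: "k \<le> n" "card P = p ^ k"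
    using lagrange[OF assms(3)] assms(1,2) divides_primepow_nat by (metis dvd_triv_right)
  moreover have "\<not> p dvd card (rcosets P - {P})"
  proof -
    have fin': "finite (rcosets P)"
      using finite_carrier by (simp add: RCOSETS_def)
    have "card P < p ^ n"
      using assms(2,4) PG finite_carrier psubset_card_mono unfolding order_def by (metis psubsetI)
    then have "k < n"
      using k assms(1) by (metis le_neq_implies_less less_irrefl)
    have "card (rcosets P) * p ^ k = p ^ (n - k) * p ^ k"
      using lagrange[OF assms(3)] assms(2) k by (simp flip: power_add)
    then have "card (rcosets P) = p ^ (n - k)"
      using assms(1) prime_gt_0_nat[of p] by simp
    then have "p dvd card (rcosets P)"
      using \<open>k < n\<close> by simp
    moreover have "card (rcosets P) = Suc (card (rcosets P - {P}))"
      using card.remove[OF fin' P] by simp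
    ultimately show ?thesis
      using assms(1) by (metis Suc_eq_plus1 dvd_add_right_iff not_prime_unit)
  qed
  moreover have "finite (rcosets P - {P})"
    using finite_carrier by (simp add: RCOSETS_def)
  ultimately obtain C where C: "C \<in> rcosets P - {P}" "\<And>v. v \<in> P \<Longrightarrow> C #> inv v = C"
    using P.p_group_acts_on_fixed_point[OF assms(1), of k "rcosets P - {P}" ?\<phi>]
    by (auto simp: order_def)
  then obtain g where g: "g \<in> carrier G" "C = P #> g"
    by (auto simp: RCOSETS_def)
  have "g \<otimes> v \<otimes> inv g \<in> P" if "v \<in> P" for v
    using rcoset_fixed_imp_conj_mem[OF assms(3) g(1)] C(2)[OF that] g(2) that PG by auto
  then have "g \<in> normalizer G P"
    using mem_normalizer_iff[OF fin PG] g(1) by blast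
  moreover have "g \<notin> P"
    using C(1) g(2) eqP by auto
  ultimately show ?thesis using that by blast
qed

text \<open>The cosets of \<open>N\<close> inside the preimage \<open>V\<close> are precisely the
  elements of \<open>U\<close>, so this is Lagrange's theorem in \<open>V\<close>. It serves both to
  lift subgroups of the quotient and to compute the order of images.\<close>

lemma card_FactGroup_preimage:
  assumes "N \<lhd> G" "subgroup U (G Mod N)"
  defines "V \<equiv> {x \<in> carrier G. N #> x \<in> U}"
  shows "subgroup V G" "card V = card U * card N"
proof -
  interpret N: normal N G by fact
  interpret Q: group "G Mod N" by (rule N.factorgroup_is_group)
  interpret pi: group_hom G "G Mod N" "\<lambda>x. N #> x"
    by unfold_locales (rule N.r_coset_hom_Mod)
  show V: "subgroup V G"
  proof
    show "V \<subseteq> carrier G" by (auto simp: V_def)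
    show "\<one> \<in> V"
      using subgroup.one_closed[OF assms(2)] pi.hom_one unfolding V_def by simp
    show "x \<otimes> y \<in> V" if "x \<in> V" "y \<in> V" for x y
      using that subgroup.m_closed[OF assms(2)] pi.hom_mult unfolding V_def by simp
    show "inv x \<in> V" if "x \<in> V" for x
      using that subgroup.m_inv_closed[OF assms(2)] pi.hom_inv unfolding V_def by auto
  qed
  have NV: "N \<subseteq> V"
    using subgroup.one_closed[OF assms(2)] N.subset coset_join2 N.subgroup_axioms unfolding V_def by auto
  have "rcosets\<^bsub>G\<lparr>carrier := V\<rparr>\<^esub> N = U"
  proof -
    have "U \<subseteq> carrier (G Mod N)" using assms(2) by (rule subgroup.subset)
    then show ?thesis
      unfolding RCOSETS_def V_def carrier_FactGroup by (auto simp: r_coset_def)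
  qed
  then show "card V = card U * card N"
    using group.lagrange[OF subgroup_imp_group[OF V] subgroup_incl[OF N.subgroup_axioms V NV]]
    by (simp add: order_def)
qed

text \<open>
  A subgroup of order \<open>p\<close> in the intersection of two conjugates lifts to a \<open>p\<close>-group \<open>V\<close> not contained
  in \<open>N\<close>, and conjugating both \<open>V\<close> and its translate into the Sylow subgroup \<open>T\<close> inside \<open>H\<close> produces an
  element to which the last hypothesis applies.
\<close>

lemma strongly_embedded_FactGroup:
  assumes "prime p" "N \<lhd> G" "subgroup H G" "H \<noteq> carrier G" "N \<subset> T" "T \<subseteq> H" "sylow_subgroup p T G"
    and control: "\<And>y v. y \<in> carrier G \<Longrightarrow> v \<in> T - N \<Longrightarrow> y \<otimes> v \<otimes> inv y \<in> T \<Longrightarrow> y \<in> H"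
  shows "strongly_embedded p ((\<lambda>x. N #> x) ` H) (G Mod N)"
proof -
  interpret N: normal N G by fact
  interpret Q: group "G Mod N" by (rule N.factorgroup_is_group)
  interpret pi: group_hom G "G Mod N" "\<lambda>x. N #> x"
    by unfold_locales (rule N.r_coset_hom_Mod)
  interpret H: finite_group "G\<lparr>carrier := H\<rparr>"
    using subgroup_finite_group[OF assms(3)] .
  let ?\<pi> = "\<lambda>x. N #> x" and ?m = "multiplicity p (order G)"
  have T: "subgroup T G" "card T = p ^ ?m"
    using assms(7) by (auto simp: sylow_subgroup_def)
  \<comment> \<open>A subgroup containing \<open>N\<close> is a union of cosets of \<open>N\<close>,
    so membership can be tested in the quotient.\<close>
  have mem: "?\<pi> x \<in> ?\<pi> ` K \<longleftrightarrow> x \<in> K"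
    if xG: "x \<in> carrier G" and K: "subgroup K G" "N \<subseteq> K" for x K
  proof
    assume "?\<pi> x \<in> ?\<pi> ` K"
    then obtain k where "k \<in> K" "x \<in> N #> k"
      using rcos_self[OF xG N.subgroup_axioms] by auto
    then show "x \<in> K"
      using K subgroup.m_closed[OF K(1)] by (auto simp: r_coset_def)
  qed auto
  have NH: "N \<subseteq> H" using assms(5,6) by blast
  have cardpi: "card K = card (?\<pi> ` K) * card N" if "subgroup K G" "N \<subseteq> K" for K
  proof -
    have "{x \<in> carrier G. ?\<pi> x \<in> ?\<pi> ` K} = K"
      using mem that subgroup.subset[OF that(1)] by blast
    then show ?thesis
      using card_FactGroup_preimage(2)[OF assms(2) pi.subgroup_img_is_subgroup[OF that(1)]] by simp
  qed
  have finT: "finite T" using finite_carrier subgroup.subset[OF T(1)] finite_subset by blast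
  have "card N < card T" using psubset_card_mono[OF finT assms(5)] .
  have cT: "card T = card (?\<pi> ` T) * card N"
    using cardpi[OF T(1)] assms(5) by blast
  obtain k where k: "card N = p ^ k"
    using cT T(2) assms(1) divides_primepow_nat by (metis dvd_triv_right)
  have subH: "subgroup (?\<pi> ` H) (G Mod N)" "subgroup (?\<pi> ` T) (G Mod N)"
    using pi.subgroup_img_is_subgroup assms(3) T(1) by blast+
  show ?thesis
    unfolding strongly_embedded_def
  proof (intro conjI ballI notI)
    show "subgroup (?\<pi> ` H) (G Mod N)" by fact
    assume "?\<pi> ` H = carrier (G Mod N)"
    then have "x \<in> H" if "x \<in> carrier G" for x
      using mem[OF that assms(3) NH] that pi.hom_closed by blast
    then show False
      using assms(3,4) subgroup.subset by blast
  next
    have "card (?\<pi> ` T) \<noteq> 1"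
      using cT \<open>card N < card T\<close> by auto
    moreover have "card (?\<pi> ` T) dvd p ^ ?m"
      using cT T(2) by (metis dvd_triv_left)
    ultimately have "p dvd card (?\<pi> ` T)"
      using assms(1) divides_primepow_nat by (metis dvd_power gr0I power_0)
    also have "card (?\<pi> ` T) dvd card (?\<pi> ` H)"
      using group.lagrange[OF Q.subgroup_imp_group[OF subH(1)] Q.subgroup_incl[OF subH(2,1)]] assms(6)
      by (simp add: order_def image_mono) (metis dvd_triv_right)
    finally show "p dvd card (?\<pi> ` H)" .
  next
    fix X
    assume "X \<in> carrier (G Mod N) - ?\<pi> ` H"
    then obtain x where x: "x \<in> carrier G" "x \<notin> H" "X = ?\<pi> x"
      by (auto simp: carrier_FactGroup)
    let ?K = "?\<pi> ` H \<inter> (X <#\<^bsub>G Mod N\<^esub> ?\<pi> ` H #>\<^bsub>G Mod N\<^esub> inv\<^bsub>G Mod N\<^esub> X)"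
    assume "p dvd card ?K"
    have XQ: "X \<in> carrier (G Mod N)" using x by (simp add: pi.hom_closed)
    have subK: "subgroup ?K (G Mod N)"
      using Q.subgroups_Inter_pair[OF subH(1) Q.subgroup_conjugation_is_surj2[OF XQ subH(1)]] .
    interpret K: group "(G Mod N)\<lparr>carrier := ?K\<rparr>"
      using Q.subgroup_imp_group[OF subK] .
    have finK: "finite ?K"
      using finite_carrier H.finite_carrier by simp
    \<comment> \<open>Cauchy's theorem, obtained as the existence of a subgroup of order
      \<open>p ^ 1\<close>.\<close>
    obtain U where U: "subgroup U ((G Mod N)\<lparr>carrier := ?K\<rparr>)" "card U = p"
      using sylow_thm[OF assms(1) K.is_group, of 1] \<open>p dvd card ?K\<close> finK
      by (auto simp: order_def dvd_def)
    have U': "subgroup U (G Mod N)" "U \<subseteq> ?K"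
      using Q.incl_subgroup[OF subK U(1)] subgroup.subset[OF U(1)] by auto
    \<comment> \<open>\<open>card N\<close> divides the order of \<open>T\<close> and is a power of
      \<open>p\<close>, so the preimage of \<open>U\<close> is a \<open>p\<close>-group as well. It
      is \<open>p\<close> times as large as \<open>N\<close>, which provides an element outside
      \<open>N\<close>.\<close>
    define V where "V = {x \<in> carrier G. ?\<pi> x \<in> U}"
    have V: "subgroup V G" "card V = p ^ Suc k"
      using card_FactGroup_preimage[OF assms(2) U'(1)] U(2) k unfolding V_def by auto
    have VG: "V \<subseteq> carrier G" using subgroup.subset[OF V(1)] .
    interpret V: group "G\<lparr>carrier := V\<rparr>"
      using subgroup_imp_group[OF V(1)] .
    have VH: "v \<in> H" if "v \<in> V" for v
      using that U'(2) mem[OF _ assms(3) NH] unfolding V_def by blast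
    \<comment> \<open>\<open>U\<close> also lies in the conjugate of the image of \<open>H\<close>
      by \<open>X\<close>, so conjugating \<open>V\<close> back by \<open>x\<close> lands in
      \<open>H\<close>. Thus both \<open>V\<close> and its translate are \<open>p\<close>-subgroups
      of \<open>H\<close>.\<close>
    have xVH: "inv x \<otimes> v \<otimes> x \<in> H" if vV: "v \<in> V" for v
    proof -
      have v: "v \<in> carrier G" using vV VG by blast
      obtain h where h: "h \<in> H" "?\<pi> v = X \<otimes>\<^bsub>G Mod N\<^esub> ?\<pi> h \<otimes>\<^bsub>G Mod N\<^esub> inv\<^bsub>G Mod N\<^esub> X"
      proof -
        have "?\<pi> v \<in> X <#\<^bsub>G Mod N\<^esub> ?\<pi> ` H #>\<^bsub>G Mod N\<^esub> inv\<^bsub>G Mod N\<^esub> X"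
          using vV U'(2) unfolding V_def by blast
        then show ?thesis
          using that unfolding l_coset_def[of "G Mod N"] r_coset_def[of "G Mod N"] by blast
      qed
      have hG: "h \<in> carrier G" using h(1) assms(3) subgroup.subset by blast
      have "?\<pi> (inv x \<otimes> v \<otimes> x) =
          inv\<^bsub>G Mod N\<^esub> X \<otimes>\<^bsub>G Mod N\<^esub> ?\<pi> v \<otimes>\<^bsub>G Mod N\<^esub> X"
        using x v by (simp add: pi.hom_mult pi.hom_inv del: mult_FactGroup)
      also have "\<dots> = ?\<pi> h"
        using h(2) XQ pi.hom_closed[OF hG] by (simp add: Q.m_assoc Q.inv_mult_cancel del: mult_FactGroup one_FactGroup)
      finally show ?thesis
        using mem[OF _ assms(3) NH] h(1) x(1) v by (metis imageI inv_closed m_closed)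
    qed
    \<comment> \<open>Working inside \<open>H\<close> makes the conjugating elements
      \<open>h\<close> and \<open>h'\<close> lie in \<open>H\<close>; otherwise nothing could be
      concluded about \<open>x\<close>.\<close>
    have sylT: "sylow_subgroup p T (G\<lparr>carrier := H\<rparr>)"
    proof -
      have TH: "subgroup T (G\<lparr>carrier := H\<rparr>)"
        using subgroup_incl[OF T(1) assms(3,6)] .
      have "card H > 0" "order G > 0"
        using H.finite_carrier finite_carrier subgroup.one_closed[OF assms(3)]
        by (auto simp: card_gt_0_iff order_gt_0_iff_finite)
      moreover have "p ^ ?m dvd card H"
        using H.lagrange[OF TH] T(2) by (simp add: order_def) (metis dvd_triv_right)
      moreover have "card H dvd order G"
        using lagrange[OF assms(3)] by (metis dvd_triv_right)
      ultimately have "multiplicity p (card H) = ?m"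
        using assms(1)
        by (metis antisym dvd_imp_multiplicity_le gr_implies_not0 not_prime_unit power_dvd_iff_le_multiplicity)
      then show ?thesis
        using TH T(2) by (simp add: sylow_subgroup_def order_def)
    qed
    have ordV: "order (G\<lparr>carrier := V\<rparr>) = p ^ Suc k" using V(2) by (simp add: order_def)
    have HG: "H \<subseteq> carrier G" using assms(3) subgroup.subset by blast
    have "(\<lambda>v. v) \<in> hom (G\<lparr>carrier := V\<rparr>) (G\<lparr>carrier := H\<rparr>)"
      using VH by (auto simp: hom_def)
    then obtain h where h: "h \<in> H" "\<And>v. v \<in> V \<Longrightarrow> h \<otimes> v \<otimes> inv h \<in> T"
      using H.sylow_conjugate[OF assms(1) V.is_group ordV _ sylT] m_inv_consistent[OF assms(3)] by auto
    have "(\<lambda>v. inv x \<otimes> v \<otimes> x) \<in> hom (G\<lparr>carrier := V\<rparr>) (G\<lparr>carrier := H\<rparr>)"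
      using xVH VG x(1) by (auto simp: hom_def m_assoc subset_iff inv_mult_cancel)
    then obtain h' where h': "h' \<in> H" "\<And>v. v \<in> V \<Longrightarrow> h' \<otimes> (inv x \<otimes> v \<otimes> x) \<otimes> inv h' \<in> T"
      using H.sylow_conjugate[OF assms(1) V.is_group ordV _ sylT] m_inv_consistent[OF assms(3)] by auto
    have "card N < card V"
      using k V(2) prime_gt_1_nat[OF assms(1)] by simp
    then obtain v where v: "v \<in> V" "v \<notin> N"
      using card_mono[of N V] N.subset finite_carrier finite_subset by (metis leD subsetI)
    define w where "w = h \<otimes> v \<otimes> inv h"
    \<comment> \<open>\<open>y\<close> undoes \<open>h\<close>, passes to the translate by
      \<open>inv x\<close> and applies \<open>h'\<close>. It therefore carries \<open>w\<close>,
      which lies in \<open>T\<close> but not in \<open>N\<close>, to another element of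
      \<open>T\<close>; once \<open>y\<close> is known to lie in \<open>H\<close>, so is
      \<open>x\<close>, a contradiction.\<close>
    define y where "y = h' \<otimes> inv x \<otimes> inv h"
    have G: "h \<in> carrier G" "h' \<in> carrier G" "v \<in> carrier G"
      using h(1) h'(1) v(1) HG VG by auto
    have "w \<notin> N"
    proof
      assume "w \<in> N"
      then have "inv h \<otimes> w \<otimes> h \<in> N"
        using N.inv_op_closed1[OF G(1)] by blast
      moreover have "inv h \<otimes> w \<otimes> h = v"
        unfolding w_def using G by (simp add: m_assoc inv_mult_cancel)
      ultimately show False using v(2) by simp
    qed
    moreover have "w \<in> T" using h(2) v(1) by (simp add: w_def)
    moreover have "y \<otimes> w \<otimes> inv y = h' \<otimes> (inv x \<otimes> v \<otimes> x) \<otimes> inv h'"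
      unfolding y_def w_def using G x(1) by (simp add: m_assoc inv_mult_group inv_mult_cancel)
    ultimately have "y \<in> H"
      using control[of y w] h'(2)[OF v(1)] G x(1) unfolding y_def by simp
    then have "inv h' \<otimes> y \<otimes> h \<in> H"
      using assms(3) h(1) h'(1) by (simp add: subgroup.m_closed subgroup.m_inv_closed)
    moreover have "inv h' \<otimes> y \<otimes> h = inv x"
      unfolding y_def using G x(1) by (simp add: m_assoc inv_mult_cancel)
    ultimately have "inv (inv x) \<in> H"
      using assms(3) by (simp add: subgroup.m_inv_closed)
    then show False using x by simp
  qed
qed

end

section \<open>Fusion systems\<close>

locale finite_fusion_system = finite_group S + fusion_system S F
  for S :: "('a, 'm) monoid_scheme" (structure) and F :: "'a homs"
begin

lemma morphismD:
  assumes "subgroup P S" "subgroup Q S" "\<phi> \<in> F P Q"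
  shows "\<phi> \<in> hom (S\<lparr>carrier := P\<rparr>) (S\<lparr>carrier := Q\<rparr>)" "inj_on \<phi> P" "\<phi> \<in> extensional P"
    and "\<phi> ` P \<subseteq> Q" "\<And>x y. x \<in> P \<Longrightarrow> y \<in> P \<Longrightarrow> \<phi> (x \<otimes> y) = \<phi> x \<otimes> \<phi> y"
  using morphism[OF assms(1,2)] assms(3) by (auto simp: hom_def)

lemma morphism_mem: "\<lbrakk>subgroup P S; subgroup Q S; \<phi> \<in> F P Q; x \<in> P\<rbrakk> \<Longrightarrow> \<phi> x \<in> Q"
  using morphismD(4) by blast

lemma morphism_inv:
  assumes "subgroup P S" "subgroup Q S" "\<phi> \<in> F P Q" "x \<in> P"
  shows "\<phi> (inv x) = inv (\<phi> x)"
proof -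
  interpret group_hom "S\<lparr>carrier := P\<rparr>" "S\<lparr>carrier := Q\<rparr>" \<phi>
    using morphismD(1)[OF assms(1-3)] assms(1,2)
    by (simp add: group_hom_def group_hom_axioms_def subgroup_imp_group)
  show ?thesis
    using hom_inv[of x] assms m_inv_consistent morphism_mem by simp
qed

lemma morphism_conj:
  assumes "subgroup P S" "subgroup Q S" "\<phi> \<in> F P Q" "g \<in> P" "x \<in> P"
  shows "\<phi> (g \<otimes> x \<otimes> inv g) = \<phi> g \<otimes> \<phi> x \<otimes> inv (\<phi> g)"
  using assms by (simp add: morphismD(5)[OF assms(1-3)] morphism_inv subgroup.m_closed
      subgroup.m_inv_closed)

lemma morphism_img_subgroup:
  assumes "subgroup P S" "subgroup Q S" "\<phi> \<in> F P Q" "subgroup P' S" "P' \<subseteq> P"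
  shows "subgroup (\<phi> ` P') S"
proof -
  note incl = incl_subgroup[OF assms(2)] and P' = subgroup_incl[OF assms(4,1,5)]
  interpret group_hom "S\<lparr>carrier := P\<rparr>" "S\<lparr>carrier := Q\<rparr>" \<phi>
    using morphismD(1)[OF assms(1-3)] assms(1,2)
    by (simp add: group_hom_def group_hom_axioms_def subgroup_imp_group)
  show ?thesis
    using incl subgroup_img_is_subgroup[OF P'] by blast
qed

lemma finite_subgroup: "subgroup P S \<Longrightarrow> finite P"
  using finite_subset[OF subgroup.subset finite_carrier] .

text \<open>An inclusion is conjugation by the identity, hence covered by the axiom
  \<open>conj\<close>.\<close>

lemma incl_mem:
  assumes "subgroup P S" "subgroup Q S" "P \<subseteq> Q"
  shows "(\<lambda>x\<in>P. x) \<in> F P Q"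
proof -
  have "(\<lambda>x\<in>P. x) = conj_map S P \<one>"
    using subgroup.mem_carrier[OF assms(1)] by (auto simp: conj_map_def restrict_def fun_eq_iff)
  moreover have "conj_map S P \<one> ` P \<subseteq> Q"
    using assms(3) calculation by (metis image_restrict_eq image_ident)
  ultimately have "(\<lambda>x\<in>P. x) \<in> Hom_grp S P Q"
    unfolding Hom_grp_def by blast
  then show ?thesis using conj[OF assms(1,2)] by blast
qed

lemma morphism_restrict_mem:
  assumes "subgroup P S" "subgroup Q S" "\<phi> \<in> F P Q" "subgroup P' S" "P' \<subseteq> P"
  shows "restrict \<phi> P' \<in> F P' Q"
proof -
  have "compose P' \<phi> (\<lambda>x\<in>P'. x) \<in> F P' Q"
    using comp[OF assms(4,1,2) incl_mem[OF assms(4,1,5)] assms(3)] .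
  moreover have "compose P' \<phi> (\<lambda>x\<in>P'. x) = restrict \<phi> P'"
    by (auto simp: compose_def restrict_def)
  ultimately show ?thesis by simp
qed

section \<open>Isomorphisms of the fusion system\<close>

lemma Iso_fusE:
  assumes "\<phi> \<in> Iso_fus F P Q" "subgroup P S" "subgroup Q S"
  obtains \<psi> where "\<phi> \<in> F P Q" "\<psi> \<in> Iso_fus F Q P" "\<psi> \<in> F Q P" "\<phi> ` P = Q"
    "\<And>x. x \<in> P \<Longrightarrow> \<psi> (\<phi> x) = x" "\<And>y. y \<in> Q \<Longrightarrow> \<phi> (\<psi> y) = y"
proof -
  obtain \<psi> where \<psi>: "\<phi> \<in> F P Q" "\<psi> \<in> F Q P" "compose P \<psi> \<phi> = (\<lambda>x\<in>P. x)" "compose Q \<phi> \<psi> = (\<lambda>x\<in>Q. x)"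
    using assms(1) by (auto simp: Iso_fus_def)
  have inv: "\<psi> (\<phi> x) = x" if "x \<in> P" for x
    using fun_cong[OF \<psi>(3), of x] that by (simp add: compose_def)
  moreover have inv': "\<phi> (\<psi> y) = y" if "y \<in> Q" for y
    using fun_cong[OF \<psi>(4), of y] that by (simp add: compose_def)
  moreover have "\<phi> ` P = Q"
    using inv' morphism_mem assms(2,3) \<psi>(1,2) by (metis image_eqI image_subsetI subsetI subset_antisym)
  moreover have "\<psi> \<in> Iso_fus F Q P"
    using \<psi> by (auto simp: Iso_fus_def)
  ultimately show ?thesis using that \<psi> by blast
qed

lemma Iso_fus_comp:
  assumes "subgroup P S" "subgroup Q S" "subgroup R S" "\<phi> \<in> Iso_fus F P Q" "\<psi> \<in> Iso_fus F Q R"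
  shows "compose P \<psi> \<phi> \<in> Iso_fus F P R"
proof -
  obtain \<phi>' where \<phi>: "\<phi> \<in> F P Q" "\<phi>' \<in> F Q P" "\<And>x. x \<in> P \<Longrightarrow> \<phi>' (\<phi> x) = x" "\<And>y. y \<in> Q \<Longrightarrow> \<phi> (\<phi>' y) = y"
    using Iso_fusE[OF assms(4,1,2)] by metis
  obtain \<psi>' where \<psi>: "\<psi> \<in> F Q R" "\<psi>' \<in> F R Q" "\<And>x. x \<in> Q \<Longrightarrow> \<psi>' (\<psi> x) = x" "\<And>y. y \<in> R \<Longrightarrow> \<psi> (\<psi>' y) = y"
    using Iso_fusE[OF assms(5,2,3)] by metis
  note mem = morphism_mem[OF assms(1,2) \<phi>(1)] morphism_mem[OF assms(2,1) \<phi>(2)]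
    morphism_mem[OF assms(2,3) \<psi>(1)] morphism_mem[OF assms(3,2) \<psi>(2)]
  have "compose P (compose R \<phi>' \<psi>') (compose P \<psi> \<phi>) = (\<lambda>x\<in>P. x)"
    "compose R (compose P \<psi> \<phi>) (compose R \<phi>' \<psi>') = (\<lambda>x\<in>R. x)"
    using \<phi> \<psi> mem by (auto simp: compose_def restrict_def fun_eq_iff)
  then show ?thesis
    using comp[OF assms(1-3) \<phi>(1) \<psi>(1)] comp[OF assms(3,2,1) \<psi>(2) \<phi>(2)] by (auto simp: Iso_fus_def)
qed

text \<open>The axiom \<open>factor\<close> yields an isomorphism onto an unnamed \<open>R\<close>;
  comparing values identifies it with the restriction of \<open>\<phi>\<close>, and \<open>R\<close>
  with the image. Images under morphisms are thereby \<open>F\<close>-conjugate to their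
  sources.\<close>

lemma restrict_mem_Iso_fus:
  assumes "subgroup P S" "subgroup Q S" "\<phi> \<in> F P Q" "subgroup P' S" "P' \<subseteq> P"
  shows "restrict \<phi> P' \<in> Iso_fus F P' (\<phi> ` P')"
proof -
  obtain R \<psi> where R: "subgroup R S" "R \<subseteq> Q" "\<psi> \<in> Iso_fus F P' R"
    "restrict \<phi> P' = compose P' (\<lambda>x\<in>R. x) \<psi>"
    using factor[OF assms(4,2) morphism_restrict_mem[OF assms]] by blast
  have \<psi>: "\<psi> \<in> F P' R" "\<psi> ` P' = R"
    using Iso_fusE[OF R(3) assms(4) R(1)] by metis+
  have "restrict \<phi> P' = \<psi>"
  proof (rule extensionalityI)
    show "restrict \<phi> P' \<in> extensional P'" "\<psi> \<in> extensional P'"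
      using morphismD(3)[OF assms(4) R(1) \<psi>(1)] by auto
    show "restrict \<phi> P' x = \<psi> x" if "x \<in> P'" for x
      using fun_cong[OF R(4), of x] that \<psi>(2) by (auto simp: compose_def)
  qed
  then show ?thesis
    using R(3) \<psi>(2) by (metis image_restrict_eq)
qed

lemma mem_Iso_fus:
  assumes "subgroup P S" "subgroup Q S" "\<phi> \<in> F P Q" "\<phi> ` P = Q"
  shows "\<phi> \<in> Iso_fus F P Q"
  using restrict_mem_Iso_fus[OF assms(1-3,1)] morphismD(3)[OF assms(1-3)] assms(4)
  by (simp add: extensional_restrict)

lemma aut_image:
  assumes "subgroup P S" "\<alpha> \<in> F P P"
  shows "\<alpha> ` P = P"
  using morphismD(2,4)[OF assms(1,1,2)] finite_subgroup[OF assms(1)] by (simp add: endo_inj_surj)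

lemma aut_mem_Iso_fus: "subgroup P S \<Longrightarrow> \<alpha> \<in> F P P \<Longrightarrow> \<alpha> \<in> Iso_fus F P P"
  using mem_Iso_fus aut_image by blast

lemma aut_mem_auto: "subgroup P S \<Longrightarrow> F P P \<subseteq> auto (S\<lparr>carrier := P\<rparr>)"
  using morphismD aut_image unfolding auto_def Bij_def bij_betw_def by force

section \<open>The automorphism groups of the fusion system\<close>

lemma carrier_Aut_fus: "carrier (Aut_fus S F P) = F P P"
  by (simp add: Aut_fus_def)

lemma one_Aut_fus: "\<one>\<^bsub>Aut_fus S F P\<^esub> = (\<lambda>x\<in>P. x)"
  by (simp add: Aut_fus_def AutoGroup_def BijGroup_def)

lemma mult_Aut_fus:
  assumes "subgroup P S" "\<alpha> \<in> F P P" "\<beta> \<in> F P P"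
  shows "\<alpha> \<otimes>\<^bsub>Aut_fus S F P\<^esub> \<beta> = compose P \<alpha> \<beta>"
proof -
  have "\<alpha> \<in> Bij P" "\<beta> \<in> Bij P"
    using aut_mem_auto[OF assms(1)] assms(2,3) by (auto simp: auto_def)
  then show ?thesis
    by (simp add: Aut_fus_def AutoGroup_def BijGroup_def)
qed

text \<open>Inverses exist because an injective endomorphism of the finite \<open>P\<close> is onto
  and then invertible within \<open>F\<close>; finiteness comes from the morphisms being
  extensional.\<close>

lemma finite_group_Aut_fus:
  assumes "subgroup P S"
  shows "finite_group (Aut_fus S F P)"
proof -
  have "group (Aut_fus S F P)"
  proof (rule groupI)
    show "\<alpha> \<otimes>\<^bsub>Aut_fus S F P\<^esub> \<beta> \<in> carrier (Aut_fus S F P)"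
      if "\<alpha> \<in> carrier (Aut_fus S F P)" "\<beta> \<in> carrier (Aut_fus S F P)" for \<alpha> \<beta>
      using that comp[OF assms assms assms] mult_Aut_fus[OF assms] by (simp add: carrier_Aut_fus)
    show "\<one>\<^bsub>Aut_fus S F P\<^esub> \<in> carrier (Aut_fus S F P)"
      using ident[OF assms] by (simp add: carrier_Aut_fus one_Aut_fus)
    show "\<alpha> \<otimes>\<^bsub>Aut_fus S F P\<^esub> \<beta> \<otimes>\<^bsub>Aut_fus S F P\<^esub> \<gamma> =
        \<alpha> \<otimes>\<^bsub>Aut_fus S F P\<^esub> (\<beta> \<otimes>\<^bsub>Aut_fus S F P\<^esub> \<gamma>)"
      if "\<alpha> \<in> carrier (Aut_fus S F P)" "\<beta> \<in> carrier (Aut_fus S F P)"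
        "\<gamma> \<in> carrier (Aut_fus S F P)" for \<alpha> \<beta> \<gamma>
    proof -
      have F: "\<alpha> \<in> F P P" "\<beta> \<in> F P P" "\<gamma> \<in> F P P"
        using that by (simp_all add: carrier_Aut_fus)
      have "\<gamma> \<in> P \<rightarrow> P"
        using morphism_mem[OF assms assms F(3)] by blast
      then show ?thesis
        using F by (simp add: mult_Aut_fus[OF assms] comp[OF assms assms assms] compose_assoc)
    qed
    show "\<one>\<^bsub>Aut_fus S F P\<^esub> \<otimes>\<^bsub>Aut_fus S F P\<^esub> \<alpha> = \<alpha>" if "\<alpha> \<in> carrier (Aut_fus S F P)" for \<alpha>
    proof -
      have F: "\<alpha> \<in> F P P" using that by (simp add: carrier_Aut_fus)
      then have "\<alpha> \<in> P \<rightarrow> P"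
        using morphism_mem[OF assms assms F] by blast
      then show ?thesis
        using F ident[OF assms] morphismD(3)[OF assms assms F]
        by (simp add: mult_Aut_fus[OF assms] one_Aut_fus)
    qed
    show "\<exists>\<beta>\<in>carrier (Aut_fus S F P). \<beta> \<otimes>\<^bsub>Aut_fus S F P\<^esub> \<alpha> = \<one>\<^bsub>Aut_fus S F P\<^esub>"
      if "\<alpha> \<in> carrier (Aut_fus S F P)" for \<alpha>
      using that aut_mem_Iso_fus[OF assms, of \<alpha>] mult_Aut_fus[OF assms]
      by (auto simp: carrier_Aut_fus one_Aut_fus Iso_fus_def)
  qed
  moreover have "F P P \<subseteq> P \<rightarrow>\<^sub>E P"
    using morphismD(3) morphism_mem assms by (auto simp: PiE_def)
  then have "finite (F P P)"
    by (rule finite_subset) (intro finite_PiE finite_subgroup[OF assms])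
  ultimately show ?thesis
    by (simp add: finite_group_def finite_group_axioms_def carrier_Aut_fus)
qed

section \<open>Normalizers and automorphisms induced by conjugation\<close>

lemma conj_map_mem_Aut_grp_iff:
  assumes "subgroup P S" "g \<in> carrier S"
  shows "conj_map S P g ` P \<subseteq> P \<longleftrightarrow> g \<in> normalizer S P"
  using mem_normalizer_iff[OF finite_subgroup[OF assms(1)] subgroup.subset[OF assms(1)]] assms(2)
  by (auto simp: conj_map_def)

lemma Aut_grp_eq: "subgroup P S \<Longrightarrow> Aut_grp S P = conj_map S P ` normalizer S P"
  using conj_map_mem_Aut_grp_iff subgroup.subset[OF normalizer_subgroup[OF subgroup.subset]]
  unfolding Hom_grp_def by blast

lemma normalizerD:
  assumes "subgroup P S" "g \<in> normalizer S P"
  shows "g \<in> carrier S" "\<And>x. x \<in> P \<Longrightarrow> g \<otimes> x \<otimes> inv g \<in> P" "\<And>x. x \<in> P \<Longrightarrow> inv g \<otimes> x \<otimes> g \<in> P"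
proof -
  note N = mem_normalizer_iff[OF finite_subgroup[OF assms(1)] subgroup.subset[OF assms(1)]]
  have "inv g \<in> normalizer S P"
    using normalizer_subgroup[OF subgroup.subset[OF assms(1)]] assms(2) by (simp add: subgroup.m_inv_closed)
  then show "\<And>x. x \<in> P \<Longrightarrow> inv g \<otimes> x \<otimes> g \<in> P" using N assms(2) by simp
qed (use assms mem_normalizer_iff[OF finite_subgroup[OF assms(1)] subgroup.subset[OF assms(1)]] in auto)

lemma normalizerI:
  assumes "subgroup P S" "g \<in> carrier S" "\<And>x. x \<in> P \<Longrightarrow> g \<otimes> x \<otimes> inv g \<in> P"
  shows "g \<in> normalizer S P"
  using mem_normalizer_iff[OF finite_subgroup[OF assms(1)] subgroup.subset[OF assms(1)]] assms by blast

lemma subset_normalizer: "subgroup P S \<Longrightarrow> P \<subseteq> normalizer S P"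
  by (intro subsetI normalizerI) (simp_all add: subgroup.m_closed subgroup.m_inv_closed subgroup.mem_carrier)

lemma conj_map_mem: "subgroup P S \<Longrightarrow> g \<in> normalizer S P \<Longrightarrow> conj_map S P g \<in> F P P"
  using Aut_grp_eq conj by blast

lemma Inn_grp_eq:
  assumes "subgroup P S"
  shows "Inn_grp S P = conj_map S P ` P"
proof -
  have "conj_map (S\<lparr>carrier := P\<rparr>) P g = conj_map S P g" if "g \<in> P" for g
    using that m_inv_consistent[OF assms] by (simp add: conj_map_def)
  moreover have "conj_map S P g ` P \<subseteq> P" if "g \<in> P" for g
    using that subset_normalizer[OF assms] conj_map_mem_Aut_grp_iff[OF assms] subgroup.mem_carrier[OF assms]
    by blast
  ultimately show ?thesis
    unfolding Hom_grp_def
    by (simp add: set_eq_iff image_iff) (metis (no_types, lifting))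
qed

lemma conj_map_hom:
  assumes "subgroup P S"
  shows "conj_map S P \<in> hom (S\<lparr>carrier := normalizer S P\<rparr>) (Aut_fus S F P)"
proof (rule homI)
  show "conj_map S P g \<in> carrier (Aut_fus S F P)" if "g \<in> carrier (S\<lparr>carrier := normalizer S P\<rparr>)" for g
    using that conj_map_mem[OF assms] by (simp add: carrier_Aut_fus)
  show "conj_map S P (g \<otimes>\<^bsub>S\<lparr>carrier := normalizer S P\<rparr>\<^esub> h) =
      conj_map S P g \<otimes>\<^bsub>Aut_fus S F P\<^esub> conj_map S P h"
    if "g \<in> carrier (S\<lparr>carrier := normalizer S P\<rparr>)" "h \<in> carrier (S\<lparr>carrier := normalizer S P\<rparr>)" for g h
    using that mult_Aut_fus[OF assms] conj_map_mem[OF assms] normalizerD[OF assms] subgroup.mem_carrier[OF assms]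
    by (auto simp: conj_map_def compose_def restrict_def fun_eq_iff m_assoc inv_mult_group)
qed

text \<open>An automorphism \<open>\<alpha>\<close> turns conjugation by \<open>g\<close> into
  conjugation by \<open>\<alpha> g\<close>.\<close>

lemma Inn_grp_normal:
  assumes "subgroup P S"
  shows "Inn_grp S P \<lhd> Aut_fus S F P"
proof -
  interpret A: finite_group "Aut_fus S F P" using finite_group_Aut_fus[OF assms] .
  interpret c: group_hom "S\<lparr>carrier := normalizer S P\<rparr>" "Aut_fus S F P" "conj_map S P"
    using conj_map_hom[OF assms] subgroup_imp_group[OF normalizer_subgroup[OF subgroup.subset[OF assms]]]
    by (simp add: group_hom_def group_hom_axioms_def A.is_group)
  have sub: "subgroup (Inn_grp S P) (Aut_fus S F P)"
    unfolding Inn_grp_eq[OF assms]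
    using c.subgroup_img_is_subgroup
      subgroup_incl[OF assms normalizer_subgroup[OF subgroup.subset[OF assms]] subset_normalizer[OF assms]] .
  show ?thesis
  proof (rule A.normal_invI[OF sub])
    fix \<alpha> i assume "\<alpha> \<in> carrier (Aut_fus S F P)" "i \<in> Inn_grp S P"
    then obtain g where \<alpha>: "\<alpha> \<in> F P P" and g: "g \<in> P" "i = conj_map S P g"
      unfolding Inn_grp_eq[OF assms] carrier_Aut_fus by blast
    have N: "g \<in> normalizer S P" "\<alpha> g \<in> P" "\<alpha> g \<in> normalizer S P"
      using g \<alpha> morphism_mem[OF assms assms] subset_normalizer[OF assms] by auto
    have F: "i \<in> F P P" "conj_map S P (\<alpha> g) \<in> F P P"
      using conj_map_mem[OF assms] N g by auto
    have "compose P \<alpha> i = compose P (conj_map S P (\<alpha> g)) \<alpha>"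
      using g \<alpha> morphism_mem[OF assms assms \<alpha>] morphism_conj[OF assms assms \<alpha> g(1)]
      by (auto simp: compose_def restrict_def fun_eq_iff conj_map_def)
    then have "\<alpha> \<otimes>\<^bsub>Aut_fus S F P\<^esub> i = conj_map S P (\<alpha> g) \<otimes>\<^bsub>Aut_fus S F P\<^esub> \<alpha>"
      using mult_Aut_fus[OF assms] \<alpha> F by simp
    then have "\<alpha> \<otimes>\<^bsub>Aut_fus S F P\<^esub> i \<otimes>\<^bsub>Aut_fus S F P\<^esub> inv\<^bsub>Aut_fus S F P\<^esub> \<alpha> = conj_map S P (\<alpha> g)"
      using \<alpha> F by (simp add: A.m_assoc flip: carrier_Aut_fus)
    then show "\<alpha> \<otimes>\<^bsub>Aut_fus S F P\<^esub> i \<otimes>\<^bsub>Aut_fus S F P\<^esub> inv\<^bsub>Aut_fus S F P\<^esub> \<alpha> \<in> Inn_grp S P"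
      unfolding Inn_grp_eq[OF assms] using N by blast
  qed
qed

section \<open>Extenders and receptive subgroups\<close>

lemma mem_extender_iff:
  assumes "subgroup P S" "subgroup Q S" "\<phi> \<in> Iso_fus F Q P"
  shows "g \<in> extender S Q P \<phi> \<longleftrightarrow> g \<in> normalizer S Q \<and>
    (\<exists>h\<in>normalizer S P. \<forall>x\<in>Q. \<phi> (g \<otimes> x \<otimes> inv g) = h \<otimes> \<phi> x \<otimes> inv h)"
proof -
  have \<phi>: "\<phi> \<in> F Q P" "\<phi> ` Q = P"
    using Iso_fusE[OF assms(3,2,1)] by metis+
  have inj: "inj_on \<phi> Q" using morphismD(2)[OF assms(2,1) \<phi>(1)] .
  \<comment> \<open>Substituting \<open>y = \<phi> x\<close> removes \<open>inv_into\<close>: what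
    remains is that \<open>\<phi>\<close> intertwines conjugation by \<open>g\<close> with
    conjugation by some \<open>h\<close>, the form in which extenders are used from here on.\<close>
  have "(\<lambda>x\<in>P. \<phi> (conj_map S Q g (inv_into Q \<phi> x))) = conj_map S P h \<longleftrightarrow>
      (\<forall>x\<in>Q. \<phi> (g \<otimes> x \<otimes> inv g) = h \<otimes> \<phi> x \<otimes> inv h)" for h
  proof -
    have "(\<lambda>x\<in>P. \<phi> (conj_map S Q g (inv_into Q \<phi> x))) = conj_map S P h \<longleftrightarrow>
        (\<forall>y\<in>P. \<phi> (conj_map S Q g (inv_into Q \<phi> y)) = h \<otimes> y \<otimes> inv h)"
      by (auto simp: conj_map_def restrict_def fun_eq_iff)
    also have "\<dots> \<longleftrightarrow> (\<forall>x\<in>Q. \<phi> (g \<otimes> x \<otimes> inv g) = h \<otimes> \<phi> x \<otimes> inv h)"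
      unfolding \<phi>(2)[symmetric] using inj by (simp add: conj_map_def)
    finally show ?thesis .
  qed
  then show ?thesis
    unfolding extender_def Aut_grp_eq[OF assms(1)] by auto
qed

text \<open>The witnesses \<open>h\<close> multiply and invert along with the elements
  \<open>g\<close> that they accompany.\<close>

lemma extender_subgroup:
  assumes "subgroup P S" "subgroup Q S" "\<phi> \<in> Iso_fus F Q P"
  shows "subgroup (extender S Q P \<phi>) S"
proof -
  note ext = mem_extender_iff[OF assms]
  note NQ = normalizer_subgroup[OF subgroup.subset[OF assms(2)]]
    and NP = normalizer_subgroup[OF subgroup.subset[OF assms(1)]]
  note DQ = normalizerD[OF assms(2)] and DP = normalizerD[OF assms(1)]
  have \<phi>: "\<phi> \<in> F Q P" "\<phi> ` Q = P"
    using Iso_fusE[OF assms(3,2,1)] by metis+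
  have \<phi>P: "\<phi> x \<in> carrier S" if "x \<in> Q" for x
    using morphism_mem[OF assms(2,1) \<phi>(1) that] subgroup.mem_carrier[OF assms(1)] by blast
  have QS: "x \<in> carrier S" if "x \<in> Q" for x
    using that subgroup.mem_carrier[OF assms(2)] by blast
  show ?thesis
  proof (rule subgroupI)
    show "extender S Q P \<phi> \<subseteq> carrier S"
      using ext DQ(1) by blast
    have "\<one> \<in> extender S Q P \<phi>"
      unfolding ext using subgroup.one_closed[OF NQ] subgroup.one_closed[OF NP] \<phi>P QS
      by (intro conjI bexI[of _ \<one>]) auto
    then show "extender S Q P \<phi> \<noteq> {}" by blast
  next
    fix g assume "g \<in> extender S Q P \<phi>"
    then obtain h where g: "g \<in> normalizer S Q" and h: "h \<in> normalizer S P"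
      "\<And>x. x \<in> Q \<Longrightarrow> \<phi> (g \<otimes> x \<otimes> inv g) = h \<otimes> \<phi> x \<otimes> inv h"
      unfolding ext by blast
    have "\<phi> (inv g \<otimes> x \<otimes> inv (inv g)) = inv h \<otimes> \<phi> x \<otimes> inv (inv h)" if "x \<in> Q" for x
    proof -
      have y: "inv g \<otimes> x \<otimes> g \<in> Q" using DQ(3)[OF g that] .
      have "g \<otimes> (inv g \<otimes> x \<otimes> g) \<otimes> inv g = x"
        using DQ(1)[OF g] QS[OF that] by (simp add: m_assoc inv_mult_cancel)
      then have "\<phi> x = h \<otimes> \<phi> (inv g \<otimes> x \<otimes> g) \<otimes> inv h"
        using h(2)[OF y] by simp
      then show ?thesis
        using DQ(1)[OF g] DP(1)[OF h(1)] \<phi>P[OF y] by (simp add: m_assoc inv_mult_cancel)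
    qed
    then show "inv g \<in> extender S Q P \<phi>"
      unfolding ext using subgroup.m_inv_closed[OF NQ g] subgroup.m_inv_closed[OF NP h(1)] by blast
  next
    fix g g' assume "g \<in> extender S Q P \<phi>" "g' \<in> extender S Q P \<phi>"
    then obtain h h' where g: "g \<in> normalizer S Q" and h: "h \<in> normalizer S P"
      "\<And>x. x \<in> Q \<Longrightarrow> \<phi> (g \<otimes> x \<otimes> inv g) = h \<otimes> \<phi> x \<otimes> inv h"
      and g': "g' \<in> normalizer S Q" and h': "h' \<in> normalizer S P"
      "\<And>x. x \<in> Q \<Longrightarrow> \<phi> (g' \<otimes> x \<otimes> inv g') = h' \<otimes> \<phi> x \<otimes> inv h'"
      unfolding ext by blast
    have "\<phi> (g \<otimes> g' \<otimes> x \<otimes> inv (g \<otimes> g')) = h \<otimes> h' \<otimes> \<phi> x \<otimes> inv (h \<otimes> h')" if "x \<in> Q" for x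
      using h(2)[OF DQ(2)[OF g' that]] h'(2)[OF that] DQ(1)[OF g] DQ(1)[OF g'] DP(1)[OF h(1)]
        DP(1)[OF h'(1)] \<phi>P[OF that] QS[OF that]
      by (simp add: m_assoc inv_mult_group)
    then show "g \<otimes> g' \<in> extender S Q P \<phi>"
      unfolding ext using subgroup.m_closed[OF NQ g g'] subgroup.m_closed[OF NP h(1) h'(1)] by blast
  qed
qed

text \<open>For \<open>g\<close> in \<open>Q\<close> the witness is \<open>\<phi> g\<close>.\<close>

lemma subset_extender:
  assumes "subgroup P S" "subgroup Q S" "\<phi> \<in> Iso_fus F Q P"
  shows "Q \<subseteq> extender S Q P \<phi>"
proof
  fix g assume g: "g \<in> Q"
  have \<phi>: "\<phi> \<in> F Q P"
    using Iso_fusE[OF assms(3,2,1)] by metis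
  then show "g \<in> extender S Q P \<phi>"
    unfolding mem_extender_iff[OF assms]
    using morphism_conj[OF assms(2,1) \<phi> g] morphism_mem[OF assms(2,1) \<phi> g]
      subset_normalizer[OF assms(1)] subset_normalizer[OF assms(2)] g by blast
qed

text \<open>Such a \<open>g\<close> acts trivially on \<open>Q\<close>, so the identity is a witness
  for every \<open>\<phi>\<close>.\<close>

lemma centralizer_subset_extender:
  assumes "subgroup P S" "subgroup Q S" "\<phi> \<in> Iso_fus F Q P"
  shows "centralizer S Q \<subseteq> extender S Q P \<phi>"
proof
  fix g assume "g \<in> centralizer S Q"
  then have g: "g \<in> carrier S" "\<And>x. x \<in> Q \<Longrightarrow> g \<otimes> x = x \<otimes> g"
    by (auto simp: centralizer_def)
  have \<phi>: "\<phi> \<in> F Q P"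
    using Iso_fusE[OF assms(3,2,1)] by metis
  have gx: "g \<otimes> x \<otimes> inv g = x" if "x \<in> Q" for x
    using g that subgroup.mem_carrier[OF assms(2)] by (simp add: m_assoc)
  show "g \<in> extender S Q P \<phi>"
    unfolding mem_extender_iff[OF assms]
    using gx normalizerI[OF assms(2) g(1)] subgroup.one_closed[OF normalizer_subgroup[OF subgroup.subset[OF assms(1)]]]
      morphism_mem[OF assms(2,1) \<phi>] subgroup.mem_carrier[OF assms(1)]
    by (intro conjI bexI[of _ \<one>]) auto
qed

text \<open>\<open>receptive\<close> leaves the target of the extension open. Enlarging it to
  \<open>carrier S\<close> gives all extensions the common form assumed by the induction hypothesis
  in Alperin's theorem.\<close>

lemma receptive_extend:
  assumes "receptive S F R" "subgroup R S" "subgroup Q S" "\<phi> \<in> Iso_fus F Q R"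
  obtains \<psi> where "\<psi> \<in> F (extender S Q R \<phi>) (carrier S)" "\<And>x. x \<in> Q \<Longrightarrow> \<psi> x = \<phi> x"
proof -
  let ?N = "extender S Q R \<phi>"
  have N: "subgroup ?N S" using extender_subgroup[OF assms(2-4)] .
  obtain R' \<psi> where \<psi>: "subgroup R' S" "\<psi> \<in> F ?N R'" "\<And>x. x \<in> Q \<Longrightarrow> \<psi> x = \<phi> x"
    using assms unfolding receptive_def by blast
  have "compose ?N (\<lambda>x\<in>R'. x) \<psi> \<in> F ?N (carrier S)"
    using comp[OF N \<psi>(1) subgroup_self \<psi>(2) incl_mem[OF \<psi>(1) subgroup_self]]
      subgroup.subset[OF \<psi>(1)] by blast
  moreover have "compose ?N (\<lambda>x\<in>R'. x) \<psi> x = \<phi> x" if "x \<in> Q" for x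
    using that subset_extender[OF assms(2-4)] morphism_mem[OF N \<psi>(1,2)] \<psi>(3)
    by (metis compose_eq restrict_apply' subsetD)
  ultimately show ?thesis using that by blast
qed

text \<open>
  Conjugation by \<open>\<phi>\<close> sends \<open>Aut\<^sub>S(Q)\<close> to a \<open>p\<close>-subgroup of \<open>Aut\<^sub>F(R)\<close>, so some \<open>\<alpha>\<close> moves it into the
  Sylow subgroup \<open>Aut\<^sub>S(R)\<close>.
\<close>

lemma extend_to_normalizer:
  assumes "prime p" "order S = p ^ n" "fully_automized p S F R" "receptive S F R"
    and "subgroup R S" "subgroup Q S" "\<phi> \<in> Iso_fus F Q R"
  obtains \<alpha> \<psi> where "\<alpha> \<in> F R R" "\<psi> \<in> F (normalizer S Q) (carrier S)" "\<And>x. x \<in> Q \<Longrightarrow> \<psi> x = \<alpha> (\<phi> x)"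
proof -
  let ?N = "normalizer S Q" and ?A = "Aut_fus S F R"
  interpret A: finite_group ?A using finite_group_Aut_fus[OF assms(5)] .
  have N: "subgroup ?N S" using normalizer_subgroup[OF subgroup.subset[OF assms(6)]] .
  obtain \<phi>' where \<phi>: "\<phi> \<in> F Q R" "\<phi>' \<in> F R Q" "\<phi> ` Q = R"
      "\<And>x. x \<in> Q \<Longrightarrow> \<phi>' (\<phi> x) = x" "\<And>y. y \<in> R \<Longrightarrow> \<phi> (\<phi>' y) = y"
    using Iso_fusE[OF assms(7,6,5)] by metis
  note mem = morphism_mem[OF assms(6,5) \<phi>(1)] morphism_mem[OF assms(5,6) \<phi>(2)]
  \<comment> \<open>\<open>f g\<close> is conjugation by \<open>g\<close>, transported from
    \<open>Q\<close> to \<open>R\<close> along \<open>\<phi>\<close>.\<close>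
  define f where "f g = compose R \<phi> (compose R (conj_map S Q g) \<phi>')" for g
  have fF: "f g \<in> F R R" if "g \<in> ?N" for g
    unfolding f_def using comp[OF assms(5,6,5) comp[OF assms(5,6,6) \<phi>(2) conj_map_mem[OF assms(6) that]] \<phi>(1)] .
  have fx: "f g x = \<phi> (g \<otimes> \<phi>' x \<otimes> inv g)" if "x \<in> R" for g x
    unfolding f_def using that mem by (simp add: compose_def conj_map_def)
  have "f \<in> hom (S\<lparr>carrier := ?N\<rparr>) ?A"
  proof (rule homI)
    show "f g \<in> carrier ?A" if "g \<in> carrier (S\<lparr>carrier := ?N\<rparr>)" for g
      using that fF by (simp add: carrier_Aut_fus)
    show "f (g \<otimes>\<^bsub>S\<lparr>carrier := ?N\<rparr>\<^esub> h) = f g \<otimes>\<^bsub>?A\<^esub> f h"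
      if "g \<in> carrier (S\<lparr>carrier := ?N\<rparr>)" "h \<in> carrier (S\<lparr>carrier := ?N\<rparr>)" for g h
    proof (rule extensionalityI)
      have gh: "g \<in> ?N" "h \<in> ?N" using that by auto
      show "f (g \<otimes>\<^bsub>S\<lparr>carrier := ?N\<rparr>\<^esub> h) \<in> extensional R" by (simp add: f_def)
      show "f g \<otimes>\<^bsub>?A\<^esub> f h \<in> extensional R"
        by (simp add: mult_Aut_fus[OF assms(5) fF[OF gh(1)] fF[OF gh(2)]])
      fix x assume x: "x \<in> R"
      have "f g (f h x) = \<phi> (g \<otimes> (h \<otimes> \<phi>' x \<otimes> inv h) \<otimes> inv g)"
        using fx[OF x] fx[OF morphism_mem[OF assms(5,5) fF[OF gh(2)] x]]
          \<phi>(4) normalizerD(2)[OF assms(6) gh(2) mem(2)[OF x]] by simp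
      also have "g \<otimes> (h \<otimes> \<phi>' x \<otimes> inv h) \<otimes> inv g = g \<otimes> h \<otimes> \<phi>' x \<otimes> inv (g \<otimes> h)"
        using normalizerD(1)[OF assms(6)] gh subgroup.mem_carrier[OF assms(6) mem(2)[OF x]]
        by (simp add: m_assoc inv_mult_group)
      finally show "f (g \<otimes>\<^bsub>S\<lparr>carrier := ?N\<rparr>\<^esub> h) x = (f g \<otimes>\<^bsub>?A\<^esub> f h) x"
        using x fx[OF x] by (simp add: mult_Aut_fus[OF assms(5) fF[OF gh(1)] fF[OF gh(2)]] compose_def)
    qed
  qed
  moreover obtain k where "order (S\<lparr>carrier := ?N\<rparr>) = p ^ k"
    using lagrange[OF N] assms(1,2) divides_primepow_nat unfolding order_def
    by (metis dvd_triv_right partial_object.select_convs(1) partial_object.simps(3) partial_object.surjective partial_object.update_convs(1))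
  ultimately obtain \<alpha> where \<alpha>: "\<alpha> \<in> F R R"
    "\<And>g. g \<in> ?N \<Longrightarrow> \<alpha> \<otimes>\<^bsub>?A\<^esub> f g \<otimes>\<^bsub>?A\<^esub> inv\<^bsub>?A\<^esub> \<alpha> \<in> Aut_grp S R"
    using A.sylow_conjugate[OF assms(1) subgroup_imp_group[OF N], of k f "Aut_grp S R"] assms(3)
    unfolding fully_automized_def carrier_Aut_fus by auto
  \<comment> \<open>After the correction by \<open>\<alpha>\<close>, each element of
    \<open>normalizer S Q\<close> induces on \<open>R\<close> conjugation by an element of
    \<open>normalizer S R\<close>, so the extender of \<open>?\<chi>\<close> is all of
    \<open>normalizer S Q\<close>.\<close>
  let ?\<chi> = "compose Q \<alpha> \<phi>"
  have \<chi>: "?\<chi> \<in> Iso_fus F Q R"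
    using Iso_fus_comp[OF assms(6,5,5,7) aut_mem_Iso_fus[OF assms(5) \<alpha>(1)]] .
  have "g \<in> extender S Q R ?\<chi>" if g: "g \<in> ?N" for g
  proof -
    obtain h where h: "h \<in> normalizer S R" "\<alpha> \<otimes>\<^bsub>?A\<^esub> f g \<otimes>\<^bsub>?A\<^esub> inv\<^bsub>?A\<^esub> \<alpha> = conj_map S R h"
      using \<alpha>(2)[OF g] unfolding Aut_grp_eq[OF assms(5)] by blast
    have "\<alpha> \<otimes>\<^bsub>?A\<^esub> f g = conj_map S R h \<otimes>\<^bsub>?A\<^esub> \<alpha>"
      using A.inv_solve_right[of "conj_map S R h" "\<alpha> \<otimes>\<^bsub>?A\<^esub> f g" \<alpha>] h(2) \<alpha>(1) fF[OF g]
        conj_map_mem[OF assms(5) h(1)] A.m_closed[of \<alpha> "f g"]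
      by (simp add: carrier_Aut_fus)
    then have eq: "compose R \<alpha> (f g) = compose R (conj_map S R h) \<alpha>"
      using mult_Aut_fus[OF assms(5)] \<alpha>(1) fF[OF g] conj_map_mem[OF assms(5) h(1)] by simp
    have "?\<chi> (g \<otimes> x \<otimes> inv g) = h \<otimes> ?\<chi> x \<otimes> inv h" if x: "x \<in> Q" for x
      using fun_cong[OF eq, of "\<phi> x"] mem(1)[OF x] fx[OF mem(1)[OF x], of g] \<phi>(4)[OF x] x
        morphism_mem[OF assms(5,5) \<alpha>(1)] normalizerD(2)[OF assms(6) g x]
      by (simp add: compose_def conj_map_def)
    then show ?thesis
      unfolding mem_extender_iff[OF assms(5,6) \<chi>] using g h(1) by blast
  qed
  then have "extender S Q R ?\<chi> = ?N"
    using mem_extender_iff[OF assms(5,6) \<chi>] by blast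
  then obtain \<psi> where "\<psi> \<in> F ?N (carrier S)" "\<And>x. x \<in> Q \<Longrightarrow> \<psi> x = ?\<chi> x"
    using receptive_extend[OF assms(4-6) \<chi>] by metis
  then show ?thesis using that \<alpha>(1) by (simp add: compose_def)
qed

text \<open>For a conjugate \<open>Q\<close>, an isomorphism onto \<open>R\<close> can be chosen to
  extend to \<open>normalizer S Q\<close>; the extension is injective and sends normalizing elements
  of \<open>Q\<close> to normalizing elements of \<open>R\<close>.\<close>

lemma fully_automized_receptive_imp_fully_normalized:
  assumes "prime p" "order S = p ^ n" "fully_automized p S F R" "receptive S F R" "subgroup R S"
  shows "fully_normalized S F R"
  unfolding fully_normalized_def
proof (intro allI impI)
  fix Q assume "F_conj S F R Q"
  then obtain \<phi> where Q: "subgroup Q S" and \<phi>: "\<phi> \<in> Iso_fus F R Q"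
    by (auto simp: F_conj_def)
  obtain \<phi>' where \<phi>': "\<phi>' \<in> Iso_fus F Q R"
    using Iso_fusE[OF \<phi> assms(5) Q] by metis
  have \<phi>'R: "\<phi>' ` Q = R"
    using Iso_fusE[OF \<phi>' Q assms(5)] by metis
  obtain \<alpha> \<psi> where \<psi>: "\<alpha> \<in> F R R" "\<psi> \<in> F (normalizer S Q) (carrier S)"
    "\<And>x. x \<in> Q \<Longrightarrow> \<psi> x = \<alpha> (\<phi>' x)"
    using extend_to_normalizer[OF assms(1-5) Q \<phi>'] by metis
  have N: "subgroup (normalizer S Q) S"
    using normalizer_subgroup[OF subgroup.subset[OF Q]] .
  have img: "\<psi> ` Q = R"
    using \<psi>(3) aut_image[OF assms(5) \<psi>(1)] \<phi>'R by (metis (no_types, lifting) image_cong image_image)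
  have "\<psi> g \<in> normalizer S R" if g: "g \<in> normalizer S Q" for g
  proof (rule normalizerI[OF assms(5)])
    show "\<psi> g \<in> carrier S" using morphism_mem[OF N subgroup_self \<psi>(2) g] .
    show "\<psi> g \<otimes> y \<otimes> inv (\<psi> g) \<in> R" if "y \<in> R" for y
    proof -
      obtain x where x: "x \<in> Q" "y = \<psi> x" using \<open>y \<in> R\<close> img by blast
      have "\<psi> g \<otimes> y \<otimes> inv (\<psi> g) = \<psi> (g \<otimes> x \<otimes> inv g)"
        using morphism_conj[OF N subgroup_self \<psi>(2) g] x subset_normalizer[OF Q] by auto
      then show ?thesis
        using normalizerD(2)[OF Q g x(1)] img by auto
    qed
  qed
  then show "card (normalizer S Q) \<le> card (normalizer S R)"
    using morphismD(2)[OF N subgroup_self \<psi>(2)]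
      finite_subgroup[OF normalizer_subgroup[OF subgroup.subset[OF assms(5)]]]
    by (intro card_inj_on_le[of \<psi>]) auto
qed

subsection \<open>Alperin's fusion theorem\<close>

text \<open>Asking for all subgroups of \<open>P\<close>, and not for \<open>P\<close> alone, makes
  the property pass to restrictions: that is how a statement about a larger subgroup, where an
  extension lives, comes back to \<open>P\<close>.\<close>

definition preserves :: "('a set \<Rightarrow> 'b) \<Rightarrow> 'a set \<Rightarrow> ('a \<Rightarrow> 'a) \<Rightarrow> bool" where
  "preserves m P \<phi> \<longleftrightarrow> (\<forall>Q. subgroup Q S \<longrightarrow> Q \<subseteq> P \<longrightarrow> m (\<phi> ` Q) = m Q)"

lemma preservesD: "\<lbrakk>preserves m P \<phi>; subgroup Q S; Q \<subseteq> P\<rbrakk> \<Longrightarrow> m (\<phi> ` Q) = m Q"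
  by (simp add: preserves_def)

lemma subgroup_preserves:
  assumes "subgroup R S"
  shows "subgroup {\<alpha> \<in> F R R. preserves m R \<alpha>} (Aut_fus S F R)"
proof -
  interpret A: finite_group "Aut_fus S F R" using finite_group_Aut_fus[OF assms] .
  note img = morphism_img_subgroup[OF assms assms]
  show ?thesis
  proof (rule A.subgroupI)
    show "{\<alpha> \<in> F R R. preserves m R \<alpha>} \<subseteq> carrier (Aut_fus S F R)"
      by (auto simp: carrier_Aut_fus)
    have "(\<lambda>x\<in>R. x) ` Q = Q" if "Q \<subseteq> R" for Q
      using that by force
    then have "(\<lambda>x\<in>R. x) \<in> {\<alpha> \<in> F R R. preserves m R \<alpha>}"
      using ident[OF assms] by (simp add: preserves_def)
    then show "{\<alpha> \<in> F R R. preserves m R \<alpha>} \<noteq> {}" by blast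
  next
    fix \<alpha> assume \<alpha>: "\<alpha> \<in> {\<alpha> \<in> F R R. preserves m R \<alpha>}"
    let ?\<beta> = "inv\<^bsub>Aut_fus S F R\<^esub> \<alpha>"
    have \<beta>: "?\<beta> \<in> F R R"
      using \<alpha> A.inv_closed[of \<alpha>] by (simp add: carrier_Aut_fus)
    have "compose R \<alpha> ?\<beta> = (\<lambda>x\<in>R. x)"
      using \<alpha> \<beta> A.r_inv[of \<alpha>] by (simp add: carrier_Aut_fus one_Aut_fus mult_Aut_fus[OF assms])
    then have "\<alpha> (?\<beta> x) = x" if "x \<in> R" for x
      using that by (metis compose_eq restrict_apply')
    then have "\<alpha> ` ?\<beta> ` Q = Q" if "Q \<subseteq> R" for Q
      using that by (force simp: image_image)
    \<comment> \<open>For the inverse, the invariance under \<open>\<alpha>\<close> is applied to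
      the image of \<open>Q\<close> under \<open>?\<beta>\<close>, which \<open>\<alpha>\<close>
      maps back to \<open>Q\<close>.\<close>
    moreover have "m (\<alpha> ` ?\<beta> ` Q) = m (?\<beta> ` Q)" if "subgroup Q S" "Q \<subseteq> R" for Q
      using \<alpha> preservesD img[OF \<beta> that] morphismD(4)[OF assms assms \<beta>] that by blast
    ultimately show "?\<beta> \<in> {\<alpha> \<in> F R R. preserves m R \<alpha>}"
      using \<beta> by (auto simp: preserves_def)
  next
    fix \<alpha> \<beta> assume \<alpha>: "\<alpha> \<in> {\<alpha> \<in> F R R. preserves m R \<alpha>}" and "\<beta> \<in> {\<alpha> \<in> F R R. preserves m R \<alpha>}"
    then have \<beta>: "\<beta> \<in> F R R" "preserves m R \<beta>" by auto
    have "compose R \<alpha> \<beta> ` Q = \<alpha> ` \<beta> ` Q" if "Q \<subseteq> R" for Q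
      using that by (force simp: compose_def image_image)
    moreover have "m (\<alpha> ` \<beta> ` Q) = m Q" if "subgroup Q S" "Q \<subseteq> R" for Q
      using \<alpha> preservesD[of m R \<alpha>] preservesD[OF \<beta>(2) that] img[OF \<beta>(1) that]
        morphismD(4)[OF assms assms \<beta>(1)] that by (simp add: image_mono subset_trans) (metis image_mono subset_trans)
    ultimately show "\<alpha> \<otimes>\<^bsub>Aut_fus S F R\<^esub> \<beta> \<in> {\<alpha> \<in> F R R. preserves m R \<alpha>}"
      using \<alpha> \<beta> comp[OF assms assms assms] by (simp add: preserves_def mult_Aut_fus[OF assms])
  qed
qed

text \<open>
  The automorphisms of \<open>R\<close> that preserve \<open>m\<close> form a subgroup containing every automorphism that
  extends to a larger subgroup. If it is proper, then \<open>R\<close> is centric, as otherwise every automorphism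
  extends to \<open>R C\<^sub>S(R)\<close>, and its image in \<open>Out\<^sub>F(R)\<close> is strongly \<open>p\<close>-embedded.
\<close>

lemma aut_preserves:
  assumes "prime p" "order S = p ^ n" "fully_automized p S F R" "receptive S F R"
    and "subgroup R S" "R \<noteq> carrier S"
    and IH: "\<And>P \<phi>. subgroup P S \<Longrightarrow> R \<subset> P \<Longrightarrow> \<phi> \<in> F P (carrier S) \<Longrightarrow> preserves m P \<phi>"
    and ess: "\<And>\<alpha>. F_essential p S F R \<Longrightarrow> \<alpha> \<in> F R R \<Longrightarrow> preserves m R \<alpha>"
    and "\<alpha> \<in> F R R"
  shows "preserves m R \<alpha>"
proof (rule ccontr)
  assume not_pres: "\<not> preserves m R \<alpha>"
  let ?A = "Aut_fus S F R" and ?N = "normalizer S R" and ?H = "{\<alpha> \<in> F R R. preserves m R \<alpha>}"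
  let ?Inn = "Inn_grp S R"
  interpret A: finite_group ?A using finite_group_Aut_fus[OF assms(5)] .
  \<comment> \<open>One element of the extender outside \<open>R\<close> is enough: by receptivity
    \<open>\<beta>\<close> extends to the whole extender, where \<open>IH\<close> applies.\<close>
  have extends: "preserves m R \<beta>"
    if \<beta>: "\<beta> \<in> F R R" and g: "g \<in> extender S R R \<beta>" "g \<notin> R" for \<beta> g
  proof -
    have iso: "\<beta> \<in> Iso_fus F R R" using aut_mem_Iso_fus[OF assms(5) \<beta>] .
    obtain \<psi> where \<psi>: "\<psi> \<in> F (extender S R R \<beta>) (carrier S)" "\<And>x. x \<in> R \<Longrightarrow> \<psi> x = \<beta> x"
      using receptive_extend[OF assms(4,5,5) iso] by metis
    have R: "R \<subset> extender S R R \<beta>"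
      using subset_extender[OF assms(5,5) iso] g by blast
    have "preserves m (extender S R R \<beta>) \<psi>"
      using IH[OF extender_subgroup[OF assms(5,5) iso] R \<psi>(1)] .
    moreover have "\<psi> ` Q = \<beta> ` Q" if "Q \<subseteq> R" for Q
      using that \<psi>(2) by (auto simp: image_iff subset_iff)
    ultimately show ?thesis
      using R unfolding preserves_def by (metis psubset_imp_subset subset_trans)
  qed
  \<comment> \<open>An element \<open>z\<close> centralizing a conjugate \<open>Q\<close> from
    outside is first carried to \<open>R\<close>: an isomorphism onto \<open>R\<close> extends to
    \<open>z\<close>, and the image centralizes \<open>R\<close> and lies outside it. It then
    belongs to the extender of \<open>\<alpha>\<close>, so \<open>\<alpha>\<close> would preserve
    \<open>m\<close>.\<close>
  have centric: "F_centric S F R"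
    unfolding F_centric_def
  proof (intro allI impI subsetI, rule ccontr)
    fix Q z assume "F_conj S F R Q" and z: "z \<in> centralizer S Q" "z \<notin> Q"
    then obtain \<phi>0 where Q: "subgroup Q S" and \<phi>0: "\<phi>0 \<in> Iso_fus F R Q"
      by (auto simp: F_conj_def)
    obtain \<phi> where \<phi>: "\<phi> \<in> Iso_fus F Q R"
      using Iso_fusE[OF \<phi>0 assms(5) Q] by metis
    have \<phi>R: "\<phi> ` Q = R"
      using Iso_fusE[OF \<phi> Q assms(5)] by metis
    let ?E = "extender S Q R \<phi>"
    have E: "subgroup ?E S" "Q \<subseteq> ?E" "z \<in> ?E"
      using extender_subgroup[OF assms(5) Q \<phi>] subset_extender[OF assms(5) Q \<phi>]
        centralizer_subset_extender[OF assms(5) Q \<phi>] z(1) by auto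
    obtain \<psi> where \<psi>: "\<psi> \<in> F ?E (carrier S)" "\<And>x. x \<in> Q \<Longrightarrow> \<psi> x = \<phi> x"
      using receptive_extend[OF assms(4,5) Q \<phi>] by metis
    have img: "\<psi> ` Q = R" using \<psi>(2) \<phi>R by auto
    have "\<psi> z \<in> centralizer S R"
    proof -
      have "\<psi> z \<otimes> \<psi> x = \<psi> x \<otimes> \<psi> z" if "x \<in> Q" for x
      proof -
        have "z \<otimes> x = x \<otimes> z" using z(1) that by (simp add: centralizer_def)
        then show ?thesis
          using morphismD(5)[OF E(1) subgroup_self \<psi>(1)] E(2,3) that by (metis subsetD)
      qed
      then show ?thesis
        using morphism_mem[OF E(1) subgroup_self \<psi>(1) E(3)] img by (auto simp: centralizer_def)
    qed
    moreover have "\<psi> z \<notin> R"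
      using morphismD(2)[OF E(1) subgroup_self \<psi>(1)] E(2,3) z(2) img
      by (metis inj_on_image_mem_iff)
    ultimately have "preserves m R \<alpha>"
      using extends[OF assms(9)] centralizer_subset_extender[OF assms(5,5) aut_mem_Iso_fus[OF assms(5,9)]]
      by blast
    with not_pres show False by simp
  qed
  have N: "subgroup ?N S" using normalizer_subgroup[OF subgroup.subset[OF assms(5)]] .
  obtain g0 where g0: "g0 \<in> ?N" "g0 \<notin> R"
    using p_group_normalizer_grows[OF assms(1,2,5,6)] by blast
  \<comment> \<open>Conjugation by \<open>k\<close> intertwines \<open>g\<close> with its conjugate
    \<open>k \<otimes> g \<otimes> inv k\<close>. With \<open>g0\<close> this puts all of
    \<open>Aut_grp S R\<close> into \<open>?H\<close>.\<close>
  have conj_ext: "?N \<subseteq> extender S R R (conj_map S R k)" if k: "k \<in> ?N" for k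
  proof
    fix g assume g: "g \<in> ?N"
    have iso: "conj_map S R k \<in> Iso_fus F R R"
      using aut_mem_Iso_fus[OF assms(5) conj_map_mem[OF assms(5) k]] .
    have h: "k \<otimes> g \<otimes> inv k \<in> ?N"
      using k g by (intro subgroup.m_closed[OF N] subgroup.m_inv_closed[OF N])
    have "conj_map S R k (g \<otimes> x \<otimes> inv g) =
        (k \<otimes> g \<otimes> inv k) \<otimes> conj_map S R k x \<otimes> inv (k \<otimes> g \<otimes> inv k)" if x: "x \<in> R" for x
      using normalizerD(2)[OF assms(5) g x] x normalizerD(1)[OF assms(5) g] normalizerD(1)[OF assms(5) k]
        subgroup.mem_carrier[OF assms(5) x]
      by (simp add: conj_map_def m_assoc inv_mult_group inv_mult_cancel)
    then show "g \<in> extender S R R (conj_map S R k)"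
      unfolding mem_extender_iff[OF assms(5,5) iso] using g h by blast
  qed
  \<comment> \<open>Two elements inducing the same map on \<open>R\<close> differ by an element of
    its centralizer, which lies in \<open>R\<close> by centricity. Hence \<open>g0\<close> induces a
    non-inner automorphism, and \<open>?Inn\<close> is properly contained in
    \<open>Aut_grp S R\<close>.\<close>
  have inner: "g \<in> R" if g: "g \<in> ?N" "conj_map S R g \<in> ?Inn" for g
  proof -
    obtain h where h: "h \<in> R" "conj_map S R g = conj_map S R h"
      using g(2) unfolding Inn_grp_eq[OF assms(5)] by blast
    have G: "g \<in> carrier S" "h \<in> carrier S"
      using normalizerD(1)[OF assms(5) g(1)] subgroup.mem_carrier[OF assms(5) h(1)] by auto
    have "inv h \<otimes> g \<in> centralizer S R"
    proof -
      have "inv h \<otimes> g \<otimes> x = x \<otimes> (inv h \<otimes> g)" if x: "x \<in> R" for x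
      proof -
        have xS: "x \<in> carrier S" using subgroup.mem_carrier[OF assms(5) x] .
        have "g \<otimes> x \<otimes> inv g = h \<otimes> x \<otimes> inv h"
          using fun_cong[OF h(2), of x] x by (simp add: conj_map_def)
        then have "inv h \<otimes> (g \<otimes> x \<otimes> inv g) \<otimes> g = inv h \<otimes> (h \<otimes> x \<otimes> inv h) \<otimes> g"
          by simp
        then show ?thesis
          using G xS by (simp add: m_assoc inv_mult_cancel)
      qed
      then show ?thesis
        using G by (simp add: centralizer_def)
    qed
    moreover have "F_conj S F R R"
      using aut_mem_Iso_fus[OF assms(5,9)] assms(5) by (auto simp: F_conj_def)
    ultimately have "inv h \<otimes> g \<in> R"
      using centric by (auto simp: F_centric_def)
    then have "h \<otimes> (inv h \<otimes> g) \<in> R"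
      using subgroup.m_closed[OF assms(5) h(1)] by blast
    then show ?thesis
      using G by (simp add: inv_mult_cancel)
  qed
  have "strongly_embedded p ((\<lambda>x. ?Inn #>\<^bsub>?A\<^esub> x) ` ?H) (?A Mod ?Inn)"
  proof (rule A.strongly_embedded_FactGroup[OF assms(1) Inn_grp_normal[OF assms(5)] subgroup_preserves[OF assms(5)]])
    show "?H \<noteq> carrier ?A"
      using assms(9) not_pres by (auto simp: carrier_Aut_fus)
    show "?Inn \<subset> Aut_grp S R"
      using inner g0 subset_normalizer[OF assms(5)]
      unfolding Aut_grp_eq[OF assms(5)] by (auto simp: Inn_grp_eq[OF assms(5)])
    show "Aut_grp S R \<subseteq> ?H"
      unfolding Aut_grp_eq[OF assms(5)]
      using conj_map_mem[OF assms(5)] extends conj_ext g0 by blast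
    show "sylow_subgroup p (Aut_grp S R) ?A"
      using assms(3) by (simp add: fully_automized_def)
    fix \<beta> v assume \<beta>: "\<beta> \<in> carrier ?A" and v: "v \<in> Aut_grp S R - ?Inn"
      and conj: "\<beta> \<otimes>\<^bsub>?A\<^esub> v \<otimes>\<^bsub>?A\<^esub> inv\<^bsub>?A\<^esub> \<beta> \<in> Aut_grp S R"
    have \<beta>': "\<beta> \<in> F R R" using \<beta> by (simp add: carrier_Aut_fus)
    obtain g where g: "g \<in> ?N" "v = conj_map S R g"
      using v unfolding Aut_grp_eq[OF assms(5)] by blast
    have "g \<notin> R"
      using v g(2) by (auto simp: Inn_grp_eq[OF assms(5)])
    obtain h where h: "h \<in> ?N" "\<beta> \<otimes>\<^bsub>?A\<^esub> v \<otimes>\<^bsub>?A\<^esub> inv\<^bsub>?A\<^esub> \<beta> = conj_map S R h"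
      using conj unfolding Aut_grp_eq[OF assms(5)] by blast
    have F: "v \<in> F R R" "conj_map S R h \<in> F R R"
      using conj_map_mem[OF assms(5)] g h(1) by auto
    \<comment> \<open>The hypothesis on the conjugate of \<open>v\<close> is the intertwining
      equation that puts \<open>g\<close> into the extender of \<open>\<beta>\<close>; as
      \<open>v\<close> is not inner, \<open>g\<close> lies outside \<open>R\<close>.\<close>
    have "\<beta> \<otimes>\<^bsub>?A\<^esub> v = conj_map S R h \<otimes>\<^bsub>?A\<^esub> \<beta>"
      using A.inv_solve_right[of "conj_map S R h" "\<beta> \<otimes>\<^bsub>?A\<^esub> v" \<beta>] h(2) \<beta> F A.m_closed[of \<beta> v]
      by (simp add: carrier_Aut_fus)
    then have eq: "compose R \<beta> v = compose R (conj_map S R h) \<beta>"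
      using mult_Aut_fus[OF assms(5)] \<beta>' F by simp
    have "\<beta> (g \<otimes> x \<otimes> inv g) = h \<otimes> \<beta> x \<otimes> inv h" if "x \<in> R" for x
      using fun_cong[OF eq, of x] that g(2) morphism_mem[OF assms(5,5) \<beta>' that]
      by (simp add: compose_def conj_map_def)
    then have "g \<in> extender S R R \<beta>"
      unfolding mem_extender_iff[OF assms(5,5) aut_mem_Iso_fus[OF assms(5) \<beta>']] using g(1) h(1) by blast
    then show "\<beta> \<in> ?H"
      using extends[OF \<beta>'] \<open>g \<notin> R\<close> \<beta>' by blast
  qed
  then have "F_essential p S F R"
    using centric fully_automized_receptive_imp_fully_normalized[OF assms(1-5)] assms(5)
    unfolding F_essential_def Out_fus_def by blast
  then show False
    using ess[OF _ assms(9)] not_pres by blast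
qed

text \<open>
  Instead of factoring \<open>\<phi>\<close> into restrictions of automorphisms, we follow a function \<open>m\<close> on the
  subgroups of \<open>S\<close> that those automorphisms leave invariant.
\<close>

theorem alperin_preserves:
  assumes "prime p" "order S = p ^ n" "saturated p S F"
    and ess: "\<And>R \<alpha>. R = carrier S \<or> F_essential p S F R \<and> R \<subset> carrier S \<Longrightarrow> \<alpha> \<in> F R R \<Longrightarrow>
        preserves m R \<alpha>"
    and "subgroup P S" "\<phi> \<in> F P (carrier S)"
  shows "preserves m P \<phi>"
  using assms(5,6)
proof (induction "order S - card P" arbitrary: P \<phi> rule: less_induct)
  case less
  show ?case
  proof (cases "P = carrier S")
    case True
    then show ?thesis using ess less.prems by blast
  next
    case False
    obtain R where R: "subgroup R S" "F_conj S F P R" "fully_automized p S F R" "receptive S F R"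
      using assms(3) less.prems(1) unfolding saturated_def F_conj_def by blast
    obtain \<rho> where \<rho>: "\<rho> \<in> Iso_fus F P R"
      using R(2) by (auto simp: F_conj_def)
    have "\<rho> ` P = R" "inj_on \<rho> P"
      using Iso_fusE[OF \<rho> less.prems(1) R(1)] morphismD(2)[OF less.prems(1) R(1)] by metis+
    then have cardR: "card R = card P" by (metis card_image)
    have cardP: "card P < order S"
      using False subgroup.subset[OF less.prems(1)] finite_carrier
      by (simp add: order_def psubset_card_mono psubset_eq)
    \<comment> \<open>Phrased by cardinality because it is applied to subgroups above
      \<open>R\<close> and above the image of \<open>P\<close>, not only above \<open>P\<close>; all
      three have the same order.\<close>
    have bigger: "preserves m P' \<psi>"
      if "subgroup P' S" "card P < card P'" "\<psi> \<in> F P' (carrier S)" for P' \<psi>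
      using less.hyps[OF _ that(1,3)] that(2) cardP by simp
    have autR: "preserves m R \<alpha>" if "\<alpha> \<in> F R R" for \<alpha>
    proof (rule aut_preserves[OF assms(1,2) R(3,4,1) _ _ _ that])
      show "R \<noteq> carrier S" using cardR cardP by (auto simp: order_def)
      then show "preserves m R \<beta>" if "F_essential p S F R" "\<beta> \<in> F R R" for \<beta>
        using ess that subgroup.subset[OF R(1)] by blast
      show "preserves m P' \<psi>" if "subgroup P' S" "R \<subset> P'" "\<psi> \<in> F P' (carrier S)" for P' \<psi>
        using bigger[OF that(1) _ that(3)] psubset_card_mono[OF finite_subgroup[OF that(1)] that(2)] cardR
        by simp
    qed
    \<comment> \<open>The composite of \<open>\<chi>\<close> with some \<open>\<alpha>\<close>
      extends to the strictly larger normalizer of \<open>Q\<close>, so it preserves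
      \<open>m\<close>; \<open>autR\<close> then strips \<open>\<alpha>\<close> off.
      \<open>Q\<close> is kept general since both \<open>P\<close> and its image under
      \<open>\<phi>\<close> will take its place.\<close>
    have iso: "preserves m Q \<chi>"
      if Q: "subgroup Q S" "card Q = card P" and \<chi>: "\<chi> \<in> Iso_fus F Q R" for Q \<chi>
      unfolding preserves_def
    proof (intro allI impI)
      fix Q' assume Q': "subgroup Q' S" "Q' \<subseteq> Q"
      obtain \<alpha> \<psi> where \<psi>: "\<alpha> \<in> F R R" "\<psi> \<in> F (normalizer S Q) (carrier S)"
        "\<And>x. x \<in> Q \<Longrightarrow> \<psi> x = \<alpha> (\<chi> x)"
        using extend_to_normalizer[OF assms(1,2) R(3,4,1) Q(1) \<chi>] by metis
      have N: "subgroup (normalizer S Q) S"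
        using normalizer_subgroup[OF subgroup.subset[OF Q(1)]] .
      have "Q \<noteq> carrier S" using Q(2) cardP by (auto simp: order_def)
      then have "Q \<subset> normalizer S Q"
        using p_group_normalizer_grows[OF assms(1,2) Q(1)] subset_normalizer[OF Q(1)] by blast
      then have "preserves m (normalizer S Q) \<psi>"
        using bigger[OF N _ \<psi>(2)] psubset_card_mono[OF finite_subgroup[OF N], of Q] Q(2) by simp
      then have "m (\<psi> ` Q') = m Q'"
        using preservesD Q' \<open>Q \<subset> normalizer S Q\<close> by blast
      moreover have "\<psi> ` Q' = \<alpha> ` \<chi> ` Q'"
        using \<psi>(3) Q'(2) by (force simp: image_image)
      moreover have "\<chi> \<in> F Q R" using \<chi> by (simp add: Iso_fus_def)
      then have "m (\<alpha> ` \<chi> ` Q') = m (\<chi> ` Q')"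
        using preservesD[OF autR[OF \<psi>(1)]] morphism_img_subgroup[OF Q(1) R(1) _ Q']
          morphismD(4)[OF Q(1) R(1)] Q'(2) by (metis image_mono subset_trans)
      ultimately show "m (\<chi> ` Q') = m Q'" by simp
    qed
    let ?Q = "\<phi> ` P"
    have Q: "subgroup ?Q S"
      using morphism_img_subgroup[OF less.prems(1) subgroup_self less.prems(2,1)] by simp
    have cardQ: "card ?Q = card P"
      using morphismD(2)[OF less.prems(1) subgroup_self less.prems(2)] by (simp add: card_image)
    have "\<phi> \<in> Iso_fus F P ?Q"
      using restrict_mem_Iso_fus[OF less.prems(1) subgroup_self less.prems(2,1)]
        morphismD(3)[OF less.prems(1) subgroup_self less.prems(2)] by (simp add: extensional_restrict)
    then obtain \<phi>' where \<phi>': "\<phi>' \<in> Iso_fus F ?Q P" "\<And>x. x \<in> P \<Longrightarrow> \<phi>' (\<phi> x) = x"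
      using Iso_fusE[OF _ less.prems(1) Q] by metis
    \<comment> \<open>This map after \<open>\<phi>\<close> is \<open>\<rho>\<close> on
      \<open>P\<close>. Both maps onto \<open>R\<close> preserve \<open>m\<close>, hence so does
      \<open>\<phi>\<close>.\<close>
    have \<chi>: "compose ?Q \<rho> \<phi>' \<in> Iso_fus F ?Q R"
      using Iso_fus_comp[OF Q less.prems(1) R(1) \<phi>'(1) \<rho>] .
    show ?thesis
      unfolding preserves_def
    proof (intro allI impI)
      fix P' assume P': "subgroup P' S" "P' \<subseteq> P"
      have "compose ?Q \<rho> \<phi>' ` \<phi> ` P' = \<rho> ` P'"
        unfolding image_image using \<phi>'(2) P'(2) by (intro image_cong refl) (auto simp: compose_eq)
      then show "m (\<phi> ` P') = m P'"
        using preservesD[OF iso[OF Q cardQ \<chi>] morphism_img_subgroup[OF less.prems(1) subgroup_self less.prems(2) P']]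
          preservesD[OF iso[OF less.prems(1) refl \<rho>] P'] P'(2) by (simp add: image_mono)
    qed
  qed
qed

section \<open>Outer invariance expressed through marks\<close>

lemma F_conj_invariant_preserves:
  assumes "subgroup P S" "\<alpha> \<in> F P P" "\<And>P Q. F_conj S F P Q \<Longrightarrow> m P = m Q"
  shows "preserves m P \<alpha>"
  unfolding preserves_def
proof (intro allI impI)
  fix Q assume Q: "subgroup Q S" "Q \<subseteq> P"
  have "F_conj S F Q (\<alpha> ` Q)"
    unfolding F_conj_def
    using Q(1) morphism_img_subgroup[OF assms(1,1,2) Q] restrict_mem_Iso_fus[OF assms(1,1,2) Q] by blast
  then show "m (\<alpha> ` Q) = m Q" using assms(3) by metis
qed

text \<open>Two members of the coset differ by an inner automorphism, so the preimages of
  \<open>H\<close> under them are conjugate in \<open>P\<close> and have equal marks. The image over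
  the coset is therefore a singleton, which gives \<open>the_elem\<close> its value.\<close>

lemma burnside_out_rcoset:
  assumes "subgroup P S" "\<alpha> \<in> F P P" "b \<in> carrier (burnside_ring (S\<lparr>carrier := P\<rparr>))"
  shows "burnside_out (S\<lparr>carrier := P\<rparr>) (Inn_grp S P #>\<^bsub>Aut_fus S F P\<^esub> \<alpha>) b =
    burnside_aut (S\<lparr>carrier := P\<rparr>) \<alpha> b"
proof -
  let ?P = "S\<lparr>carrier := P\<rparr>"
  interpret P: finite_group ?P using subgroup_finite_group[OF assms(1)] .
  interpret N: normal "Inn_grp S P" "Aut_fus S F P" using Inn_grp_normal[OF assms(1)] .
  have auto: "\<beta> \<in> auto ?P" if "\<beta> \<in> F P P" for \<beta>
    using aut_mem_auto[OF assms(1)] that by blast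
  have aut_eq: "burnside_aut ?P \<beta> b = burnside_aut ?P \<alpha> b" if \<beta>: "\<beta> \<in> \<alpha> <#\<^bsub>Aut_fus S F P\<^esub> Inn_grp S P" for \<beta>
  proof -
    obtain g where g: "g \<in> P" "\<beta> = \<alpha> \<otimes>\<^bsub>Aut_fus S F P\<^esub> conj_map S P g"
      using \<beta> unfolding l_coset_def Inn_grp_eq[OF assms(1)] by blast
    have c: "conj_map S P g \<in> F P P"
      using conj_map_mem[OF assms(1)] subset_normalizer[OF assms(1)] g(1) by blast
    have \<beta>: "\<beta> = compose P \<alpha> (conj_map S P g)"
      using g(2) mult_Aut_fus[OF assms(1,2) c] by simp
    have \<beta>F: "\<beta> \<in> F P P"
      unfolding \<beta> using comp[OF assms(1,1,1) c assms(2)] .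
    have "mark (burnside_aut ?P \<beta> b) H = mark (burnside_aut ?P \<alpha> b) H" if H: "subgroup H ?P" for H
    proof -
      interpret inv: group_hom ?P ?P "inv_into P \<beta>"
        using P.auto_inv_into(1)[OF auto[OF \<beta>F]] P.is_group by (simp add: group_hom_def group_hom_axioms_def)
      let ?K = "inv_into P \<beta> ` H" and ?c = "\<lambda>x. g \<otimes>\<^bsub>?P\<^esub> x \<otimes>\<^bsub>?P\<^esub> inv\<^bsub>?P\<^esub> g"
      have K: "subgroup ?K ?P" using inv.subgroup_img_is_subgroup[OF H] .
      have HP: "H \<subseteq> P" and KP: "?K \<subseteq> P"
        using subgroup.subset[OF H] subgroup.subset[OF K] by auto
      have "inv_into P \<alpha> h = ?c (inv_into P \<beta> h)" if "h \<in> H" for h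
      proof -
        let ?k = "inv_into P \<beta> h"
        have k: "?k \<in> P" "\<beta> ?k = h"
          using that HP KP P.auto_inv_into(2)[OF auto[OF \<beta>F], of h] by auto
        have "h = \<alpha> (?c ?k)"
          using k g(1) m_inv_consistent[OF assms(1)] by (auto simp: \<beta> compose_def conj_map_def)
        moreover have "?c ?k \<in> P" using k(1) g(1) P.m_closed P.inv_closed by auto
        ultimately show ?thesis
          using P.auto_inv_into(3)[OF auto[OF assms(2)], of "?c ?k"] by simp
      qed
      then have "inv_into P \<alpha> ` H = ?c ` ?K"
        by (simp add: image_image)
      moreover have "mark b (?c ` ?K) = mark b ?K"
        using P.mark_conj[OF assms(3) K] g(1) by simp
      ultimately show ?thesis
        using P.mark_burnside_aut[OF auto[OF \<beta>F] assms(3) H]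
          P.mark_burnside_aut[OF auto[OF assms(2)] assms(3) H] by simp
    qed
    then show ?thesis
      using P.burnside_ring_eqI P.burnside_aut_closed[OF auto assms(3)] \<beta>F assms(2) by blast
  qed
  \<comment> \<open>By normality the inner factor may be placed on the right. In that form the two
    preimages of \<open>H\<close> differ by conjugation with the same \<open>g\<close>.\<close>
  have coset: "Inn_grp S P #>\<^bsub>Aut_fus S F P\<^esub> \<alpha> = \<alpha> <#\<^bsub>Aut_fus S F P\<^esub> Inn_grp S P"
    using N.coset_eq assms(2) by (simp add: carrier_Aut_fus)
  have mem: "\<alpha> \<in> Inn_grp S P #>\<^bsub>Aut_fus S F P\<^esub> \<alpha>"
    using N.rcos_self assms(2) N.subgroup_axioms by (simp add: carrier_Aut_fus)
  have "(\<lambda>\<beta>. burnside_aut ?P \<beta> b) ` (Inn_grp S P #>\<^bsub>Aut_fus S F P\<^esub> \<alpha>) =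
      (\<lambda>_. burnside_aut ?P \<alpha> b) ` (Inn_grp S P #>\<^bsub>Aut_fus S F P\<^esub> \<alpha>)"
    by (rule image_cong[OF refl]) (rule aut_eq, simp only: coset)
  also have "\<dots> = {burnside_aut ?P \<alpha> b}"
    using mem by (rule image_constant)
  finally have "(\<lambda>\<beta>. burnside_aut ?P \<beta> b) ` (Inn_grp S P #>\<^bsub>Aut_fus S F P\<^esub> \<alpha>) =
      {burnside_aut ?P \<alpha> b}" .
  then show ?thesis
    unfolding burnside_out_def by simp
qed

text \<open>The bridge between the two halves: on subgroups of \<open>P\<close> the marks of the
  restriction are those of \<open>b\<close>, so invariance in \<open>B(P)\<close> becomes a
  statement about \<open>mark b\<close> alone, to which Alperin's theorem applies.\<close>

theorem burnside_res_mem_fixed_iff: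
  assumes "subgroup P S" "b \<in> carrier (burnside_ring S)"
  shows "burnside_res S P b \<in> burnside_fixed (S\<lparr>carrier := P\<rparr>) (carrier (Out_fus S F P)) \<longleftrightarrow>
    (\<forall>\<alpha>\<in>F P P. preserves (mark b) P \<alpha>)"
proof -
  let ?P = "S\<lparr>carrier := P\<rparr>" and ?b = "burnside_res S P b"
  interpret P: finite_group ?P using subgroup_finite_group[OF assms(1)] .
  have b: "?b \<in> carrier (burnside_ring ?P)" using burnside_res_closed[OF assms] .
  have sub: "subgroup H ?P \<longleftrightarrow> subgroup H S \<and> H \<subseteq> P" for H
    using incl_subgroup[OF assms(1)] subgroup_incl[OF _ assms(1)] subgroup.subset[of H ?P] by auto
  have "?b \<in> burnside_fixed ?P (carrier (Out_fus S F P)) \<longleftrightarrow> (\<forall>\<alpha>\<in>F P P. burnside_aut ?P \<alpha> ?b = ?b)"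
    using b burnside_out_rcoset[OF assms(1) _ b]
    by (simp add: burnside_fixed_def Out_fus_def carrier_FactGroup carrier_Aut_fus)
  also have "\<dots> \<longleftrightarrow> (\<forall>\<alpha>\<in>F P P. preserves (mark b) P \<alpha>)"
  proof (intro ball_cong refl)
    fix \<alpha> assume \<alpha>: "\<alpha> \<in> F P P"
    have "burnside_aut ?P \<alpha> ?b = ?b \<longleftrightarrow> (\<forall>H. subgroup H S \<and> H \<subseteq> P \<longrightarrow> mark ?b (\<alpha> ` H) = mark ?b H)"
      using P.burnside_aut_fixed_iff[OF subsetD[OF aut_mem_auto[OF assms(1)] \<alpha>] b] sub by simp
    also have "\<dots> \<longleftrightarrow> preserves (mark b) P \<alpha>"
    proof -
      have "mark ?b (\<alpha> ` H) = mark b (\<alpha> ` H)" "mark ?b H = mark b H" if "subgroup H S" "H \<subseteq> P" for H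
      proof -
        have "\<alpha> ` H \<subseteq> P" using morphism_mem[OF assms(1,1) \<alpha>] that(2) by blast
        then show "mark ?b (\<alpha> ` H) = mark b (\<alpha> ` H)" "mark ?b H = mark b H"
          using mark_burnside_res[OF assms] morphism_img_subgroup[OF assms(1,1) \<alpha> that] that by auto
      qed
      then show ?thesis unfolding preserves_def by auto
    qed
    finally show "burnside_aut ?P \<alpha> ?b = ?b \<longleftrightarrow> preserves (mark b) P \<alpha>" .
  qed
  finally show ?thesis .
qed

end

theorem theorem5p1:
  fixes S :: "('a, 'm) monoid_scheme" and F :: "'a homs" and p :: nat
    and b :: "'a virtual_gset set"
  assumes "prime p"
    and "finite_p_group p S"
    and "fusion_system S F"
    and "saturated p S F"
    and "b \<in> carrier (burnside_ring S)"
  shows "(b \<in> burnside_fusion S F \<longleftrightarrow>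
          (\<forall>P. subgroup P S \<longrightarrow>
             burnside_res S P b \<in>
               burnside_fixed (S\<lparr>carrier := P\<rparr>) (carrier (Out_fus S F P))))
       \<and> (b \<in> burnside_fusion S F \<longleftrightarrow>
          (\<forall>R. R = carrier S \<or> (F_essential p S F R \<and> R \<subset> carrier S) \<longrightarrow>
             burnside_res S R b \<in>
               burnside_fixed (S\<lparr>carrier := R\<rparr>) (carrier (Out_fus S F R))))"
proof -
  obtain n where S: "group S" "finite (carrier S)" "order S = p ^ n"
    using assms(2) by (auto simp: finite_p_group_def)
  interpret finite_fusion_system S F
    using S(1,2) assms(3) by (simp add: finite_fusion_system_def finite_group_def finite_group_axioms_def)
  let ?fix = "\<lambda>R. burnside_res S R b \<in> burnside_fixed (S\<lparr>carrier := R\<rparr>) (carrier (Out_fus S F R))"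
  have ess_subgroup: "subgroup R S" if "R = carrier S \<or> (F_essential p S F R \<and> R \<subset> carrier S)" for R
    using that subgroup_self by (auto simp: F_essential_def)
  have fusion_imp: "?fix P" if "b \<in> burnside_fusion S F" "subgroup P S" for P
    using burnside_res_mem_fixed_iff[OF that(2) assms(5)] F_conj_invariant_preserves[OF that(2), of _ "mark b"] that(1)
    by (simp add: burnside_fusion_def)
  have "mark b P = mark b Q"
    if fixed: "\<forall>R. R = carrier S \<or> (F_essential p S F R \<and> R \<subset> carrier S) \<longrightarrow> ?fix R"
      and PQ: "F_conj S F P Q" for P Q
  proof -
    obtain \<phi> where sub: "subgroup P S" "subgroup Q S" and \<phi>: "\<phi> \<in> Iso_fus F P Q"
      using PQ by (auto simp: F_conj_def)
    have \<phi>F: "\<phi> \<in> F P Q" "\<phi> ` P = Q"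
      using Iso_fusE[OF \<phi> sub] by metis+
    \<comment> \<open>\<open>alperin_preserves\<close> concerns morphisms into
      \<open>carrier S\<close>, so the target is enlarged; the image of \<open>P\<close> is still
      \<open>Q\<close>, and preservation at \<open>P\<close> itself is the desired equality.\<close>
    have "compose P (\<lambda>x\<in>Q. x) \<phi> \<in> F P (carrier S)"
      using comp[OF sub subgroup_self \<phi>F(1) incl_mem[OF sub(2) subgroup_self]] subgroup.subset[OF sub(2)]
      by blast
    then have "preserves (mark b) P (compose P (\<lambda>x\<in>Q. x) \<phi>)"
      using alperin_preserves[OF assms(1) S(3) assms(4) _ sub(1), of "mark b"] fixed
        burnside_res_mem_fixed_iff[OF ess_subgroup assms(5)] by blast
    moreover have "compose P (\<lambda>x\<in>Q. x) \<phi> ` P = Q"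
      using \<phi>F(2) by (auto simp: compose_def image_iff)
    ultimately show ?thesis
      using preservesD sub(1) by fastforce
  qed
  then have "b \<in> burnside_fusion S F"
    if "\<forall>R. R = carrier S \<or> (F_essential p S F R \<and> R \<subset> carrier S) \<longrightarrow> ?fix R"
    using that assms(5) by (auto simp: burnside_fusion_def)
  \<comment> \<open>Both equivalences close in one circle: fusion invariance gives the condition for
    all subgroups, in particular for \<open>carrier S\<close> and the essential ones, and these give
    back fusion invariance.\<close>
  then show ?thesis
    using fusion_imp ess_subgroup by blast
qed

end
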